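(* Let $\Theta$ be a decorated theory with pure subtheory $\Theta_0$, and let $\Theta_A=F_{\mathrm{exp}}\Theta$ with its morphism $\theta_A\colon\Theta_A\to\Theta$. For each model $M_A$ of $\Theta_A$, let $M_0$ denote the restriction of $M_A$ to $\Theta_0$, and let $\{(M,m)\mid m\colon\theta_A^{*}M\to M_A\}|_{M_0}$ denote the set of pairs $(M,m)$ with $M$ a model of $\Theta$ over $M_0$ and $m\colon\theta_A^{*}M\to M_A$ a morphism of models of $\Theta_A$ over $M_0$. Then the function which maps each element $\alpha\in M_A(A)$ to the pair $(M,m)$, where $M$ is the model of $\Theta$ (over $M_0$) such that $M(f)=M_A(f')(\alpha,-)$ for each term $f$ of $\Theta$, and where $m\colon\theta_A^{*}M\to M_A$ is the morphism of models of $\Theta_A$ (over $M_0$) such that $m_A\colon M(1)\to M_A(A)$ is the constant function with value $\alpha$, defines a bijection $$M_A(A)\;\cong\;\{(M,m)\mid m\colon\theta_A^{*}M\to M_A\}|_{M_0}.$$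
   Context: Size issues are ignored. Theories. A (equational) theory is a category with chosen finite products; its objects are called types and its morphisms terms. Morphisms of theories are functors strictly preserving the chosen finite products. The chosen terminal type is denoted $1$. $\mathrm{Set}$ is the theory of sets with cartesian products as chosen products. Models. A model of a theory $\Theta$ is a morphism of theories $M\colon\Theta\to\mathrm{Set}$; morphisms of models are natural transformations. For a morphism of theories $\theta\colon\Theta_1\to\Theta$, $\theta^{*}$ is precomposition with $\theta$: $\theta^*M=M\circ\theta$, $\theta^*m=m\circ\theta$. For a model $M_1$ of $\Theta_1$, a model $M$ of $\Theta$ is over $M_1$ if $\theta^*M=M_1$, and a morphism $m$ between models of $\Theta$ over $M_1$ is over $M_1$ if $\theta^*m=\mathrm{id}_{M_1}$. Here models of $\Theta$ and of $\Theta_A$ over $M_0$ refer to the inclusion $\Theta_0\to\Theta$ and to the canonical morphism $\Theta_0\to\Theta_A$ respectively. Decorated theories. A decorated theory is a theory $\Theta$ together with a wide subtheory $\Theta_0$ (a subcategory with the same types, containing all identities and chosen projections, closed under composition and tuples, with the same chosen products). Terms of $\Theta_0$ are called pure. The construction $F_{\mathrm{exp}}$. In a theory with a distinguished type $A$, the projections from $A\times X$ are $\mathrm{pr}_X\colon A\times X\to A$ and $\varepsilon_X\colon A\times X\to X$. $F_{\mathrm{exp}}\Theta$ is the theory $\Theta_A$ with distinguished type $A$ generated by: the theory $\Theta_0$ (all types and pure terms of $\Theta$, with their identities, composites, chosen products and tuples, so that there is a morphism of theories $\Theta_0\to\Theta_A$), a new type $A$, and a term $f'\colon A\times X\to Y$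 for each term $f\colon X\to Y$ of $\Theta$, subject to the relations: $f'=f\circ\varepsilon_X$ if $f$ is pure; $(g\circ f)'=g'\circ\langle \mathrm{pr}_X,f'\rangle$ for $f\colon X\to Y$, $g\colon Y\to Z$; and $\langle f_1,\dots,f_n\rangle'=\langle f_1',\dots,f_n'\rangle$ for all $n\ge 0$. That is, morphisms of theories $\Theta_A\to\Theta'$ correspond bijectively to a morphism of theories $\Theta_0\to\Theta'$, a type of $\Theta'$, and a family of terms of $\Theta'$ satisfying these relations. The morphism $\theta_A\colon\Theta_A\to\Theta$ is the morphism under $\Theta_0$ mapping $A$ to $1$ and $f'$ to $f$ (precisely $f\circ\varepsilon_X\colon 1\times X\to Y$). *)

theory Defs
  imports "HOL-Library.FuncSet"
begin

section \<open>Equational theories and their morphisms\<close>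

text \<open>
  Products are unbiased: a product is chosen for every finite list of types, with
  \<open>prodt T []\<close> the chosen terminal type, \<open>prodt T [X, Y]\<close> the chosen binary
  product, and \<open>proj T Xs i\<close> the projection to the \<open>i\<close>-th factor, counted from 0.
\<close>

record ('o, 'm) eqn_theory =
  types :: "'o set"
  terms :: "'m set"
  src :: "'m \<Rightarrow> 'o"
  tgt :: "'m \<Rightarrow> 'o"
  ident :: "'o \<Rightarrow> 'm"
  cmp :: "'m \<Rightarrow> 'm \<Rightarrow> 'm"
  prodt :: "'o list \<Rightarrow> 'o"
  proj :: "'o list \<Rightarrow> nat \<Rightarrow> 'm"

definition homs :: "('o, 'm) eqn_theory \<Rightarrow> 'o \<Rightarrow> 'o \<Rightarrow> 'm set" where
  "homs T X Y = {f \<in> terms T. src T f = X \<and> tgt T f = Y}"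

locale equational_theory =
  fixes T :: "('o, 'm) eqn_theory"
  assumes src_types: "f \<in> terms T \<Longrightarrow> src T f \<in> types T"
    and tgt_types: "f \<in> terms T \<Longrightarrow> tgt T f \<in> types T"
    and ident_homs: "X \<in> types T \<Longrightarrow> ident T X \<in> homs T X X"
    and cmp_homs: "\<lbrakk>f \<in> homs T X Y; g \<in> homs T Y Z\<rbrakk> \<Longrightarrow> cmp T g f \<in> homs T X Z"
    and ident_left: "f \<in> homs T X Y \<Longrightarrow> cmp T (ident T Y) f = f"
    and ident_right: "f \<in> homs T X Y \<Longrightarrow> cmp T f (ident T X) = f"
    and cmp_assoc: "\<lbrakk>f \<in> homs T W X; g \<in> homs T X Y; h \<in> homs T Y Z\<rbrakk>
        \<Longrightarrow> cmp T (cmp T h g) f = cmp T h (cmp T g f)"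
    and prodt_types: "set Xs \<subseteq> types T \<Longrightarrow> prodt T Xs \<in> types T"
    and proj_homs: "\<lbrakk>set Xs \<subseteq> types T; i < length Xs\<rbrakk>
        \<Longrightarrow> proj T Xs i \<in> homs T (prodt T Xs) (Xs ! i)"
    and prodt_universal: "\<lbrakk>X \<in> types T; set Ys \<subseteq> types T; length fs = length Ys;
          \<And>i. i < length Ys \<Longrightarrow> fs ! i \<in> homs T X (Ys ! i)\<rbrakk>
        \<Longrightarrow> \<exists>!h. h \<in> homs T X (prodt T Ys) \<and> (\<forall>i < length Ys. cmp T (proj T Ys i) h = fs ! i)"

text \<open>The common source \<open>X\<close> is an argument because it cannot be read off from an empty tuple.\<close>

definition tuple :: "('o, 'm) eqn_theory \<Rightarrow> 'o \<Rightarrow> 'm list \<Rightarrow> 'm" where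
  "tuple T X fs = (THE h. h \<in> homs T X (prodt T (map (tgt T) fs)) \<and>
     (\<forall>i < length fs. cmp T (proj T (map (tgt T) fs) i) h = fs ! i))"

record ('o, 'm, 'p, 'n) thy_map =
  ty_map :: "'o \<Rightarrow> 'p"
  tm_map :: "'m \<Rightarrow> 'n"

text \<open>
  The components of a morphism are extensional functions, so that HOL equality of
  morphisms is equality on the types and terms of the source.
\<close>

definition thy_morphism ::
    "('o, 'm) eqn_theory \<Rightarrow> ('p, 'n) eqn_theory \<Rightarrow> ('o, 'm, 'p, 'n) thy_map \<Rightarrow> bool" where
  "thy_morphism S T F \<longleftrightarrow>
     equational_theory S \<and> equational_theory T \<and>
     ty_map F \<in> types S \<rightarrow>\<^sub>E types T \<and>
     tm_map F \<in> terms S \<rightarrow>\<^sub>E terms T \<and>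
     (\<forall>f \<in> terms S. src T (tm_map F f) = ty_map F (src S f)) \<and>
     (\<forall>f \<in> terms S. tgt T (tm_map F f) = ty_map F (tgt S f)) \<and>
     (\<forall>X \<in> types S. tm_map F (ident S X) = ident T (ty_map F X)) \<and>
     (\<forall>f \<in> terms S. \<forall>g \<in> terms S. tgt S f = src S g \<longrightarrow>
        tm_map F (cmp S g f) = cmp T (tm_map F g) (tm_map F f)) \<and>
     (\<forall>Xs. set Xs \<subseteq> types S \<longrightarrow> ty_map F (prodt S Xs) = prodt T (map (ty_map F) Xs)) \<and>
     (\<forall>Xs. \<forall>i < length Xs. set Xs \<subseteq> types S \<longrightarrow>
        tm_map F (proj S Xs i) = proj T (map (ty_map F) Xs) i)"

definition thy_comp ::
    "('o, 'm) eqn_theory \<Rightarrow> ('p, 'n, 'q, 'k) thy_map \<Rightarrow> ('o, 'm, 'p, 'n) thy_map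
      \<Rightarrow> ('o, 'm, 'q, 'k) thy_map" where
  "thy_comp S G F = \<lparr>ty_map = compose (types S) (ty_map G) (ty_map F),
                     tm_map = compose (terms S) (tm_map G) (tm_map F)\<rparr>"

definition nat_trans ::
    "('o, 'm) eqn_theory \<Rightarrow> ('p, 'n) eqn_theory \<Rightarrow> ('o, 'm, 'p, 'n) thy_map
      \<Rightarrow> ('o, 'm, 'p, 'n) thy_map \<Rightarrow> ('o \<Rightarrow> 'n) \<Rightarrow> bool" where
  "nat_trans S T F G m \<longleftrightarrow>
     thy_morphism S T F \<and> thy_morphism S T G \<and>
     m \<in> extensional (types S) \<and>
     (\<forall>X \<in> types S. m X \<in> homs T (ty_map F X) (ty_map G X)) \<and>
     (\<forall>f \<in> terms S. cmp T (m (tgt S f)) (tm_map F f) = cmp T (tm_map G f) (m (src S f)))"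


section \<open>The theory of sets\<close>

text \<open>
  Sets are the subsets of a universe that contains an arbitrary type \<open>'a\<close> of atoms and
  is closed under finite tuples. The product of a list of sets is literally the set of
  tuples of their elements; in particular the terminal set is \<open>{Tuple []}\<close>.
\<close>

datatype 'a univ = Atom 'a | Tuple "'a univ list"

fun untuple :: "'a univ \<Rightarrow> 'a univ list" where
  "untuple (Tuple xs) = xs"
| "untuple (Atom a) = []"

definition cart :: "'a univ set list \<Rightarrow> 'a univ set" where
  "cart As = {Tuple xs |xs. list_all2 (\<in>) xs As}"

text \<open>A function between sets: domain, codomain, and (extensional) graph.\<close>

type_synonym 'a set_fun = "'a univ set \<times> 'a univ set \<times> ('a univ \<Rightarrow> 'a univ)"

definition app :: "'a set_fun \<Rightarrow> 'a univ \<Rightarrow> 'a univ" where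
  "app f = snd (snd f)"

definition Set_theory :: "('a univ set, 'a set_fun) eqn_theory" where
  "Set_theory = \<lparr>
     types = UNIV,
     terms = {(A, B, f). f \<in> A \<rightarrow>\<^sub>E B},
     src = fst,
     tgt = (\<lambda>f. fst (snd f)),
     ident = (\<lambda>A. (A, A, \<lambda>x\<in>A. x)),
     cmp = (\<lambda>g f. (fst f, fst (snd g), compose (fst f) (app g) (app f))),
     prodt = cart,
     proj = (\<lambda>As i. (cart As, As ! i, \<lambda>t\<in>cart As. untuple t ! i))\<rparr>"


section \<open>Models\<close>

type_synonym ('o, 'm, 'a) thy_model = "('o, 'm, 'a univ set, 'a set_fun) thy_map"

definition model :: "('o, 'm) eqn_theory \<Rightarrow> ('o, 'm, 'a) thy_model \<Rightarrow> bool" where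
  "model T M \<longleftrightarrow> thy_morphism T Set_theory M"

definition model_mor :: "('o, 'm) eqn_theory \<Rightarrow> ('o, 'm, 'a) thy_model \<Rightarrow> ('o, 'm, 'a) thy_model
    \<Rightarrow> ('o \<Rightarrow> 'a set_fun) \<Rightarrow> bool" where
  "model_mor T M N m \<longleftrightarrow> nat_trans T Set_theory M N m"

text \<open>Precomposition with a morphism \<open>F\<close> from \<open>T1\<close>, on models and on morphisms of models.\<close>

definition pull_model :: "('p, 'n) eqn_theory \<Rightarrow> ('p, 'n, 'o, 'm) thy_map \<Rightarrow> ('o, 'm, 'a) thy_model
    \<Rightarrow> ('p, 'n, 'a) thy_model" where
  "pull_model T1 F M = thy_comp T1 M F"

definition pull_mor :: "('p, 'n) eqn_theory \<Rightarrow> ('p, 'n, 'o, 'm) thy_map \<Rightarrow> ('o \<Rightarrow> 'a set_fun)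
    \<Rightarrow> ('p \<Rightarrow> 'a set_fun)" where
  "pull_mor T1 F m = compose (types T1) m (ty_map F)"

definition id_mor :: "('p, 'n) eqn_theory \<Rightarrow> ('p, 'n, 'a) thy_model \<Rightarrow> ('p \<Rightarrow> 'a set_fun)" where
  "id_mor T1 M1 = (\<lambda>X\<in>types T1. ident Set_theory (ty_map M1 X))"

definition model_over :: "('p, 'n) eqn_theory \<Rightarrow> ('o, 'm) eqn_theory \<Rightarrow> ('p, 'n, 'o, 'm) thy_map
    \<Rightarrow> ('p, 'n, 'a) thy_model \<Rightarrow> ('o, 'm, 'a) thy_model \<Rightarrow> bool" where
  "model_over T1 T F M1 M \<longleftrightarrow> model T M \<and> pull_model T1 F M = M1"

definition model_mor_over :: "('p, 'n) eqn_theory \<Rightarrow> ('o, 'm) eqn_theory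
    \<Rightarrow> ('p, 'n, 'o, 'm) thy_map \<Rightarrow> ('p, 'n, 'a) thy_model
    \<Rightarrow> ('o, 'm, 'a) thy_model \<Rightarrow> ('o, 'm, 'a) thy_model \<Rightarrow> ('o \<Rightarrow> 'a set_fun) \<Rightarrow> bool" where
  "model_mor_over T1 T F M1 M N m \<longleftrightarrow>
     model_over T1 T F M1 M \<and> model_over T1 T F M1 N \<and>
     model_mor T M N m \<and> pull_mor T1 F m = id_mor T1 M1"


section \<open>Decorated theories\<close>

text \<open>A wide subtheory is given by its set \<open>P\<close> of terms, the pure ones.\<close>

locale decorated_theory = equational_theory T
  for T :: "('o, 'm) eqn_theory" +
  fixes P :: "'m set"
  assumes pure_terms: "P \<subseteq> terms T"
    and pure_ident: "X \<in> types T \<Longrightarrow> ident T X \<in> P"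
    and pure_cmp: "\<lbrakk>f \<in> P; g \<in> P; tgt T f = src T g\<rbrakk> \<Longrightarrow> cmp T g f \<in> P"
    and pure_proj: "\<lbrakk>set Xs \<subseteq> types T; i < length Xs\<rbrakk> \<Longrightarrow> proj T Xs i \<in> P"
    and pure_tuple: "\<lbrakk>X \<in> types T; set fs \<subseteq> P; \<forall>f \<in> set fs. src T f = X\<rbrakk>
        \<Longrightarrow> tuple T X fs \<in> P"

definition pure_theory :: "('o, 'm) eqn_theory \<Rightarrow> 'm set \<Rightarrow> ('o, 'm) eqn_theory" where
  "pure_theory T P = T\<lparr>terms := P\<rparr>"

definition pure_incl :: "('o, 'm) eqn_theory \<Rightarrow> 'm set \<Rightarrow> ('o, 'm, 'o, 'm) thy_map" where
  "pure_incl T P = \<lparr>ty_map = (\<lambda>X\<in>types T. X), tm_map = (\<lambda>f\<in>P. f)\<rparr>"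


section \<open>The theory with a distinguished type\<close>

text \<open>
  Types of the generated theory, in normal form. Products are formed freely, except that a
  product of types of \<open>T\<close> is the one chosen in \<open>T\<close>, since the canonical morphism from
  the pure theory preserves chosen products strictly.
\<close>

datatype 'o exp_type =
    is_Base: Base (un_Base: 'o)
  | Dist
  | Prod "'o exp_type list"

definition exp_prod :: "('o, 'm) eqn_theory \<Rightarrow> 'o exp_type list \<Rightarrow> 'o exp_type" where
  "exp_prod T As = (if list_all is_Base As then Base (prodt T (map un_Base As)) else Prod As)"

inductive_set exp_types :: "('o, 'm) eqn_theory \<Rightarrow> 'o exp_type set"
  for T :: "('o, 'm) eqn_theory" where
  base: "X \<in> types T \<Longrightarrow> Base X \<in> exp_types T"
| dist: "Dist \<in> exp_types T"
| prod: "(\<And>A. A \<in> set As \<Longrightarrow> A \<in> exp_types T) \<Longrightarrow> exp_prod T As \<in> exp_types T"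

text \<open>Expressions for terms; \<open>EPrime f\<close> stands for the generator \<open>f'\<close>.\<close>

datatype ('o, 'm) exp_expr =
    EPure 'm
  | EPrime 'm
  | EId "'o exp_type"
  | EComp "('o, 'm) exp_expr" "('o, 'm) exp_expr"
  | EProj "'o exp_type list" nat
  | ETuple "'o exp_type" "('o, 'm) exp_expr list"

abbreviation dist_times :: "'o \<Rightarrow> 'o exp_type list" where
  "dist_times X \<equiv> [Dist, Base X]"

text \<open>\<open>exp_wt T P A B t\<close>: \<open>t\<close> is an expression for a term from \<open>A\<close> to \<open>B\<close>.\<close>

inductive exp_wt :: "('o, 'm) eqn_theory \<Rightarrow> 'm set \<Rightarrow> 'o exp_type \<Rightarrow> 'o exp_type
    \<Rightarrow> ('o, 'm) exp_expr \<Rightarrow> bool"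
  for T :: "('o, 'm) eqn_theory" and P :: "'m set" where
  pure: "f \<in> P \<Longrightarrow> exp_wt T P (Base (src T f)) (Base (tgt T f)) (EPure f)"
| prime: "f \<in> terms T \<Longrightarrow>
    exp_wt T P (exp_prod T (dist_times (src T f))) (Base (tgt T f)) (EPrime f)"
| id: "A \<in> exp_types T \<Longrightarrow> exp_wt T P A A (EId A)"
| comp: "\<lbrakk>exp_wt T P A B t; exp_wt T P B C u\<rbrakk> \<Longrightarrow> exp_wt T P A C (EComp u t)"
| proj: "\<lbrakk>set As \<subseteq> exp_types T; i < length As\<rbrakk> \<Longrightarrow>
    exp_wt T P (exp_prod T As) (As ! i) (EProj As i)"
| tuple: "\<lbrakk>A \<in> exp_types T; set Bs \<subseteq> exp_types T; length ts = length Bs;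
      \<And>i. i < length Bs \<Longrightarrow> exp_wt T P A (Bs ! i) (ts ! i)\<rbrakk> \<Longrightarrow>
    exp_wt T P A (exp_prod T Bs) (ETuple A ts)"

text \<open>
  \<open>exp_eq T P A B\<close> is the congruence on the expressions from \<open>A\<close> to \<open>B\<close> generated by the
  axioms of a theory, functoriality of the canonical morphism from the pure theory, and the
  three relations on the terms \<open>f'\<close>.
\<close>

inductive exp_eq :: "('o, 'm) eqn_theory \<Rightarrow> 'm set \<Rightarrow> 'o exp_type \<Rightarrow> 'o exp_type
    \<Rightarrow> ('o, 'm) exp_expr \<Rightarrow> ('o, 'm) exp_expr \<Rightarrow> bool"
  for T :: "('o, 'm) eqn_theory" and P :: "'m set" where
  refl: "exp_wt T P A B t \<Longrightarrow> exp_eq T P A B t t"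
| sym: "exp_eq T P A B t u \<Longrightarrow> exp_eq T P A B u t"
| trans: "\<lbrakk>exp_eq T P A B t u; exp_eq T P A B u v\<rbrakk> \<Longrightarrow> exp_eq T P A B t v"
| comp_cong: "\<lbrakk>exp_eq T P A B t t'; exp_eq T P B C u u'\<rbrakk> \<Longrightarrow>
    exp_eq T P A C (EComp u t) (EComp u' t')"
| tuple_cong: "\<lbrakk>A \<in> exp_types T; set Bs \<subseteq> exp_types T; length ts = length Bs;
      length ts' = length Bs; \<And>i. i < length Bs \<Longrightarrow> exp_eq T P A (Bs ! i) (ts ! i) (ts' ! i)\<rbrakk> \<Longrightarrow>
    exp_eq T P A (exp_prod T Bs) (ETuple A ts) (ETuple A ts')"
| id_left: "exp_wt T P A B t \<Longrightarrow> exp_eq T P A B (EComp (EId B) t) t"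
| id_right: "exp_wt T P A B t \<Longrightarrow> exp_eq T P A B (EComp t (EId A)) t"
| assoc: "\<lbrakk>exp_wt T P A B t; exp_wt T P B C u; exp_wt T P C D v\<rbrakk> \<Longrightarrow>
    exp_eq T P A D (EComp (EComp v u) t) (EComp v (EComp u t))"
| proj_tuple: "\<lbrakk>A \<in> exp_types T; set Bs \<subseteq> exp_types T; length ts = length Bs;
      \<And>i. i < length Bs \<Longrightarrow> exp_wt T P A (Bs ! i) (ts ! i); j < length Bs\<rbrakk> \<Longrightarrow>
    exp_eq T P A (Bs ! j) (EComp (EProj Bs j) (ETuple A ts)) (ts ! j)"
| tuple_proj: "\<lbrakk>set Bs \<subseteq> exp_types T; exp_wt T P A (exp_prod T Bs) t\<rbrakk> \<Longrightarrow>
    exp_eq T P A (exp_prod T Bs)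
      (ETuple A (map (\<lambda>i. EComp (EProj Bs i) t) [0..<length Bs])) t"
| pure_id: "X \<in> types T \<Longrightarrow> exp_eq T P (Base X) (Base X) (EPure (ident T X)) (EId (Base X))"
| pure_comp: "\<lbrakk>f \<in> P; g \<in> P; tgt T f = src T g\<rbrakk> \<Longrightarrow>
    exp_eq T P (Base (src T f)) (Base (tgt T g))
      (EPure (cmp T g f)) (EComp (EPure g) (EPure f))"
| pure_proj: "\<lbrakk>set Xs \<subseteq> types T; i < length Xs\<rbrakk> \<Longrightarrow>
    exp_eq T P (Base (prodt T Xs)) (Base (Xs ! i))
      (EPure (proj T Xs i)) (EProj (map Base Xs) i)"
| prime_pure: "f \<in> P \<Longrightarrow>
    exp_eq T P (exp_prod T (dist_times (src T f))) (Base (tgt T f))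
      (EPrime f) (EComp (EPure f) (EProj (dist_times (src T f)) 1))"
| prime_comp: "\<lbrakk>f \<in> terms T; g \<in> terms T; tgt T f = src T g\<rbrakk> \<Longrightarrow>
    exp_eq T P (exp_prod T (dist_times (src T f))) (Base (tgt T g))
      (EPrime (cmp T g f))
      (EComp (EPrime g)
        (ETuple (exp_prod T (dist_times (src T f)))
          [EProj (dist_times (src T f)) 0, EPrime f]))"
| prime_tuple: "\<lbrakk>X \<in> types T; set fs \<subseteq> terms T; \<forall>f \<in> set fs. src T f = X\<rbrakk> \<Longrightarrow>
    exp_eq T P (exp_prod T (dist_times X)) (Base (prodt T (map (tgt T) fs)))
      (EPrime (tuple T X fs))
      (ETuple (exp_prod T (dist_times X)) (map EPrime fs))"

text \<open>A term of the generated theory: source, target, and class of expressions.\<close>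

type_synonym ('o, 'm) exp_term = "'o exp_type \<times> 'o exp_type \<times> ('o, 'm) exp_expr set"

definition exp_class :: "('o, 'm) eqn_theory \<Rightarrow> 'm set \<Rightarrow> 'o exp_type \<Rightarrow> 'o exp_type
    \<Rightarrow> ('o, 'm) exp_expr \<Rightarrow> ('o, 'm) exp_term" where
  "exp_class T P A B t = (A, B, {u. exp_eq T P A B t u})"

definition exp_rep :: "('o, 'm) exp_term \<Rightarrow> ('o, 'm) exp_expr" where
  "exp_rep c = (SOME t. t \<in> snd (snd c))"

definition F_exp :: "('o, 'm) eqn_theory \<Rightarrow> 'm set \<Rightarrow> ('o exp_type, ('o, 'm) exp_term) eqn_theory" where
  "F_exp T P = \<lparr>
     types = exp_types T,
     terms = {exp_class T P A B t |A B t. exp_wt T P A B t},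
     src = fst,
     tgt = (\<lambda>c. fst (snd c)),
     ident = (\<lambda>A. exp_class T P A A (EId A)),
     cmp = (\<lambda>d c. exp_class T P (fst c) (fst (snd d)) (EComp (exp_rep d) (exp_rep c))),
     prodt = exp_prod T,
     proj = (\<lambda>As i. exp_class T P (exp_prod T As) (As ! i) (EProj As i))\<rparr>"

text \<open>The canonical morphism from the pure theory.\<close>

definition exp_incl :: "('o, 'm) eqn_theory \<Rightarrow> 'm set
    \<Rightarrow> ('o, 'm, 'o exp_type, ('o, 'm) exp_term) thy_map" where
  "exp_incl T P = \<lparr>
     ty_map = (\<lambda>X\<in>types T. Base X),
     tm_map = (\<lambda>f\<in>P. exp_class T P (Base (src T f)) (Base (tgt T f)) (EPure f))\<rparr>"

text \<open>The term \<open>f'\<close>.\<close>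

definition exp_prime :: "('o, 'm) eqn_theory \<Rightarrow> 'm set \<Rightarrow> 'm \<Rightarrow> ('o, 'm) exp_term" where
  "exp_prime T P f =
     exp_class T P (exp_prod T (dist_times (src T f))) (Base (tgt T f)) (EPrime f)"

text \<open>The morphism \<open>\<theta>\<^sub>A\<close>; below, \<open>prodt T [prodt T [], X]\<close> is \<open>1 \<times> X\<close> in \<open>T\<close>.\<close>

definition is_exp_theta :: "('o, 'm) eqn_theory \<Rightarrow> 'm set
    \<Rightarrow> ('o exp_type, ('o, 'm) exp_term, 'o, 'm) thy_map \<Rightarrow> bool" where
  "is_exp_theta T P F \<longleftrightarrow>
     thy_morphism (F_exp T P) T F \<and>
     thy_comp (pure_theory T P) F (exp_incl T P) = pure_incl T P \<and>
     ty_map F Dist = prodt T [] \<and>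
     (\<forall>f \<in> terms T. tm_map F (exp_prime T P f) = cmp T f (proj T [prodt T [], src T f] 1))"

definition exp_theta :: "('o, 'm) eqn_theory \<Rightarrow> 'm set
    \<Rightarrow> ('o exp_type, ('o, 'm) exp_term, 'o, 'm) thy_map" where
  "exp_theta T P = (THE F. is_exp_theta T P F)"


section \<open>Models of the generated theory\<close>

text \<open>The restriction of a model of \<open>F_exp T P\<close> to the pure theory.\<close>

definition restr0 :: "('o, 'm) eqn_theory \<Rightarrow> 'm set
    \<Rightarrow> ('o exp_type, ('o, 'm) exp_term, 'a) thy_model \<Rightarrow> ('o, 'm, 'a) thy_model" where
  "restr0 T P MA = pull_model (pure_theory T P) (exp_incl T P) MA"

definition is_model0 :: "('o, 'm) eqn_theory \<Rightarrow> 'm set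
    \<Rightarrow> ('o exp_type, ('o, 'm) exp_term, 'a) thy_model \<Rightarrow> ('o, 'm, 'a) thy_model \<Rightarrow> bool" where
  "is_model0 T P MA M \<longleftrightarrow> model_over (pure_theory T P) T (pure_incl T P) (restr0 T P MA) M"

definition is_mor0 :: "('o, 'm) eqn_theory \<Rightarrow> 'm set
    \<Rightarrow> ('o exp_type, ('o, 'm) exp_term, 'a) thy_model \<Rightarrow> ('o, 'm, 'a) thy_model
    \<Rightarrow> ('o exp_type \<Rightarrow> 'a set_fun) \<Rightarrow> bool" where
  "is_mor0 T P MA M m \<longleftrightarrow>
     model_mor_over (pure_theory T P) (F_exp T P) (exp_incl T P) (restr0 T P MA)
       (pull_model (F_exp T P) (exp_theta T P) M) MA m"

definition pairs_over :: "('o, 'm) eqn_theory \<Rightarrow> 'm set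
    \<Rightarrow> ('o exp_type, ('o, 'm) exp_term, 'a) thy_model
    \<Rightarrow> (('o, 'm, 'a) thy_model \<times> ('o exp_type \<Rightarrow> 'a set_fun)) set" where
  "pairs_over T P MA = {(M, m). is_model0 T P MA M \<and> is_mor0 T P MA M m}"

definition is_model_at :: "('o, 'm) eqn_theory \<Rightarrow> 'm set
    \<Rightarrow> ('o exp_type, ('o, 'm) exp_term, 'a) thy_model \<Rightarrow> 'a univ
    \<Rightarrow> ('o, 'm, 'a) thy_model \<Rightarrow> bool" where
  "is_model_at T P MA \<alpha> M \<longleftrightarrow>
     is_model0 T P MA M \<and>
     (\<forall>f \<in> terms T. \<forall>x \<in> ty_map M (src T f).
        app (tm_map M f) x = app (tm_map MA (exp_prime T P f)) (Tuple [\<alpha>, x]))"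

definition model_at :: "('o, 'm) eqn_theory \<Rightarrow> 'm set
    \<Rightarrow> ('o exp_type, ('o, 'm) exp_term, 'a) thy_model \<Rightarrow> 'a univ \<Rightarrow> ('o, 'm, 'a) thy_model" where
  "model_at T P MA \<alpha> = (THE M. is_model_at T P MA \<alpha> M)"

definition is_mor_at :: "('o, 'm) eqn_theory \<Rightarrow> 'm set
    \<Rightarrow> ('o exp_type, ('o, 'm) exp_term, 'a) thy_model \<Rightarrow> 'a univ
    \<Rightarrow> ('o exp_type \<Rightarrow> 'a set_fun) \<Rightarrow> bool" where
  "is_mor_at T P MA \<alpha> m \<longleftrightarrow>
     is_mor0 T P MA (model_at T P MA \<alpha>) m \<and>
     (\<forall>x \<in> ty_map (model_at T P MA \<alpha>) (prodt T []). app (m Dist) x = \<alpha>)"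

definition mor_at :: "('o, 'm) eqn_theory \<Rightarrow> 'm set
    \<Rightarrow> ('o exp_type, ('o, 'm) exp_term, 'a) thy_model \<Rightarrow> 'a univ
    \<Rightarrow> ('o exp_type \<Rightarrow> 'a set_fun)" where
  "mor_at T P MA \<alpha> = (THE m. is_mor_at T P MA \<alpha> m)"

end

theory Submission
  imports Defs
begin

text \<open>
  A morphism \<open>m\<close> over \<open>M\<^sub>0\<close> is the identity at the types of \<open>\<Theta>\<close>, and naturality with respect
  to projections determines it at products, so it amounts to the value \<open>\<alpha>\<close> of \<open>m\<^sub>A\<close> at the unique
  element of \<open>M(1)\<close>. Naturality at \<open>f'\<close> says exactly that \<open>M(f)\<close> is \<open>M\<^sub>A(f')(\<alpha>, -)\<close>, so \<open>M\<close> is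
  determined by \<open>\<alpha>\<close> as well. Conversely, the relations on the terms \<open>f'\<close> say that
  \<open>M\<^sub>A(f')(\<alpha>, -)\<close> is functorial in \<open>f\<close> and extends the pure part, and naturality of the resulting
  \<open>m\<close> follows by induction on the terms of \<open>\<Theta>\<^sub>A\<close>.
\<close>


section \<open>Theories and morphisms\<close>

text \<open>Two features of the setting shape the proof. The morphism \<open>exp_theta\<close>, the
  model \<open>model_at\<close> and the morphism \<open>mor_at\<close> are definite descriptions, so
  each must first be shown to exist and to be unique. And equality of terms in the generated theory
  is derivability between expressions, represented by classes with chosen representatives: a map out
  of it is obtained by interpreting expressions and checking every generating equation, whereas a
  statement about all terms is proved by an induction that never mentions representatives. That
  induction handles a tuple through its composites with the projections, which is enough because
  projections are jointly monic in every theory; in sets this amounts to comparing coordinates.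
  Since products are preserved strictly, \<open>M(1)\<close> is literally \<open>{Tuple []}\<close>,
  which turns the constant function \<open>m\<^sub>A\<close> into the single value
  \<open>app (m Dist) (Tuple [])\<close>.\<close>

lemma homs_terms: "f \<in> homs T X Y \<Longrightarrow> f \<in> terms T"
  and homs_src: "f \<in> homs T X Y \<Longrightarrow> src T f = X"
  by (auto simp: homs_def)

lemma homs_self: "f \<in> terms T \<Longrightarrow> f \<in> homs T (src T f) (tgt T f)"
  by (auto simp: homs_def)

context equational_theory
begin

lemma homs_types:
  assumes "f \<in> homs T X Y"
  shows "X \<in> types T" "Y \<in> types T"
  using assms src_types tgt_types by (auto simp: homs_def)

text \<open>Joint monicity of the projections: both arrows solve the universal problem posed by the
  composites of \<open>h\<close> with the projections.\<close>

lemma hom_prodt_eqI: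
  assumes h: "h \<in> homs T X (prodt T Ys)" and h': "h' \<in> homs T X (prodt T Ys)"
    and Ys: "set Ys \<subseteq> types T"
    and eq: "\<And>i. i < length Ys \<Longrightarrow> cmp T (proj T Ys i) h = cmp T (proj T Ys i) h'"
  shows "h = h'"
proof -
  let ?fs = "map (\<lambda>i. cmp T (proj T Ys i) h) [0..<length Ys]"
  have "X \<in> types T"
    using h by (rule homs_types)
  moreover have "?fs ! i \<in> homs T X (Ys ! i)" if "i < length Ys" for i
    using that cmp_homs[OF h proj_homs[OF Ys that]] by simp
  ultimately have "\<exists>!h. h \<in> homs T X (prodt T Ys) \<and>
      (\<forall>i < length Ys. cmp T (proj T Ys i) h = ?fs ! i)"
    using Ys by (intro prodt_universal) auto
  then show ?thesis
    using h h' eq by auto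
qed

lemma
  assumes X: "X \<in> types T" and Ys: "set Ys \<subseteq> types T" and len: "length fs = length Ys"
    and fs: "\<And>i. i < length Ys \<Longrightarrow> fs ! i \<in> homs T X (Ys ! i)"
  shows tuple_homs: "tuple T X fs \<in> homs T X (prodt T Ys)"
    and cmp_proj_tuple: "i < length Ys \<Longrightarrow> cmp T (proj T Ys i) (tuple T X fs) = fs ! i"
proof -
  \<comment> \<open>The definition of \<open>tuple\<close> recovers the factors from the targets of
    the components; here they are identified with \<open>Ys\<close>.\<close>
  have Ys_eq: "map (tgt T) fs = Ys"
    using len fs by (auto intro: nth_equalityI simp: homs_def)
  have "\<exists>!h. h \<in> homs T X (prodt T Ys) \<and> (\<forall>i < length fs. cmp T (proj T Ys i) h = fs ! i)"
    using prodt_universal[OF X Ys len fs] len by simp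
  from theI'[OF this] show "tuple T X fs \<in> homs T X (prodt T Ys)"
    and "i < length Ys \<Longrightarrow> cmp T (proj T Ys i) (tuple T X fs) = fs ! i"
    unfolding tuple_def Ys_eq by (auto simp: len)
qed

lemma eq_tupleI:
  assumes "h \<in> homs T X (prodt T Ys)" "set Ys \<subseteq> types T" "length fs = length Ys"
    and "\<And>i. i < length Ys \<Longrightarrow> fs ! i \<in> homs T X (Ys ! i)"
    and "\<And>i. i < length Ys \<Longrightarrow> cmp T (proj T Ys i) h = fs ! i"
  shows "h = tuple T X fs"
proof -
  have X: "X \<in> types T"
    using assms(1) by (rule homs_types)
  show ?thesis
    using assms(1) tuple_homs[OF X assms(2-4)]
    by (rule hom_prodt_eqI) (use assms cmp_proj_tuple[OF X assms(2-4)] in auto)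
qed

end

lemma
  assumes "thy_morphism S T F"
  shows thy_morphism_source: "equational_theory S"
    and thy_morphism_target: "equational_theory T"
    and ty_map_PiE: "ty_map F \<in> types S \<rightarrow>\<^sub>E types T"
    and tm_map_PiE: "tm_map F \<in> terms S \<rightarrow>\<^sub>E terms T"
    and ty_map_types: "X \<in> types S \<Longrightarrow> ty_map F X \<in> types T"
    and tm_map_homs: "f \<in> homs S X Y \<Longrightarrow> tm_map F f \<in> homs T (ty_map F X) (ty_map F Y)"
    and tm_map_ident: "X \<in> types S \<Longrightarrow> tm_map F (ident S X) = ident T (ty_map F X)"
    and tm_map_cmp: "f \<in> homs S X Y \<Longrightarrow> g \<in> homs S Y Z \<Longrightarrow>
      tm_map F (cmp S g f) = cmp T (tm_map F g) (tm_map F f)"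
    and ty_map_prodt: "set Xs \<subseteq> types S \<Longrightarrow> ty_map F (prodt S Xs) = prodt T (map (ty_map F) Xs)"
    and tm_map_proj: "set Xs \<subseteq> types S \<Longrightarrow> i < length Xs \<Longrightarrow>
      tm_map F (proj S Xs i) = proj T (map (ty_map F) Xs) i"
  using assms by (auto simp: thy_morphism_def homs_def)

lemma thy_morphism_comp:
  assumes F: "thy_morphism S T F" and G: "thy_morphism T U G"
  shows "thy_morphism S U (thy_comp S G F)"
proof -
  interpret S: equational_theory S
    using F by (rule thy_morphism_source)
  have src: "src U (tm_map G (tm_map F f)) = ty_map G (ty_map F (src S f))"
    and tgt: "tgt U (tm_map G (tm_map F f)) = ty_map G (ty_map F (tgt S f))"
    if "f \<in> terms S" for f
    using tm_map_homs[OF G tm_map_homs[OF F homs_self[OF that]]] by (auto simp: homs_def)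
  have cmp: "cmp S g f \<in> terms S"
      "tm_map G (tm_map F (cmp S g f)) = cmp U (tm_map G (tm_map F g)) (tm_map G (tm_map F f))"
    if "f \<in> terms S" "g \<in> terms S" "tgt S f = src S g" for f g
  proof -
    note fg = homs_self[OF that(1)] homs_self[OF that(2), folded that(3)]
    show "cmp S g f \<in> terms S"
      using S.cmp_homs[OF fg] by (rule homs_terms)
    show "tm_map G (tm_map F (cmp S g f)) = cmp U (tm_map G (tm_map F g)) (tm_map G (tm_map F f))"
      using tm_map_cmp[OF G fg[THEN tm_map_homs[OF F]]] tm_map_cmp[OF F fg] by simp
  qed
  have prodt: "ty_map G (ty_map F (prodt S Xs)) = prodt U (map (\<lambda>X. ty_map G (ty_map F X)) Xs)"
    if "set Xs \<subseteq> types S" for Xs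
  proof -
    have "set (map (ty_map F) Xs) \<subseteq> types T"
      using that ty_map_types[OF F] by auto
    then show ?thesis
      using ty_map_prodt[OF F that] ty_map_prodt[OF G] by (simp add: comp_def)
  qed
  have proj: "proj S Xs i \<in> terms S"
      "tm_map G (tm_map F (proj S Xs i)) = proj U (map (\<lambda>X. ty_map G (ty_map F X)) Xs) i"
    if "set Xs \<subseteq> types S" "i < length Xs" for Xs i
  proof -
    show "proj S Xs i \<in> terms S"
      using S.proj_homs[OF that] by (rule homs_terms)
    have "set (map (ty_map F) Xs) \<subseteq> types T"
      using that ty_map_types[OF F] by auto
    then show "tm_map G (tm_map F (proj S Xs i)) = proj U (map (\<lambda>X. ty_map G (ty_map F X)) Xs) i"
      using tm_map_proj[OF F that] tm_map_proj[OF G] that by (simp add: comp_def)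
  qed
  \<comment> \<open>\<open>compose\<close> is extensional, hence \<open>undefined\<close> outside
    \<open>types S\<close>, so its pointwise form is available only for lists of types.\<close>
  have map_eq: "map (compose (types S) (ty_map G) (ty_map F)) Xs
      = map (\<lambda>X. ty_map G (ty_map F X)) Xs" if "set Xs \<subseteq> types S" for Xs
    using that by (auto simp: compose_def)
  show ?thesis
    unfolding thy_morphism_def thy_comp_def
    using ty_map_PiE[OF F] ty_map_PiE[OF G] tm_map_PiE[OF F] tm_map_PiE[OF G]
      thy_morphism_target[OF G] S.equational_theory_axioms tm_map_ident[OF F] tm_map_ident[OF G]
      homs_terms[OF S.ident_homs] ty_map_types[OF F]
    by (auto simp: src tgt cmp prodt proj map_eq S.src_types S.tgt_types S.prodt_types compose_eq
        PiE_iff compose_extensional)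
qed

lemma thy_map_eqI:
  fixes F G :: "('o, 'm, 'p, 'n) thy_map"
  assumes "thy_morphism S T F" "thy_morphism S T G"
    and "\<And>X. X \<in> types S \<Longrightarrow> ty_map F X = ty_map G X"
    and "\<And>f. f \<in> terms S \<Longrightarrow> tm_map F f = tm_map G f"
  shows "F = G"
  using PiE_ext[OF ty_map_PiE[OF assms(1)] ty_map_PiE[OF assms(2)]]
    PiE_ext[OF tm_map_PiE[OF assms(1)] tm_map_PiE[OF assms(2)]] assms(3,4)
  by (intro thy_map.equality) auto


section \<open>Sets and functions\<close>

lemma set_fun_homs_iff:
  "f \<in> homs Set_theory A B \<longleftrightarrow> (\<exists>h \<in> A \<rightarrow>\<^sub>E B. f = (A, B, h))"
  by (auto simp: homs_def Set_theory_def)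

lemma set_fun_eqI:
  assumes "f \<in> homs Set_theory A B" "g \<in> homs Set_theory A B"
    and "\<And>x. x \<in> A \<Longrightarrow> app f x = app g x"
  shows "f = g"
  using assms by (auto simp: set_fun_homs_iff app_def intro: PiE_ext)

lemma app_mem: "\<lbrakk>f \<in> homs Set_theory A B; x \<in> A\<rbrakk> \<Longrightarrow> app f x \<in> B"
  by (auto simp: set_fun_homs_iff app_def)

lemma app_cmp:
  "\<lbrakk>f \<in> homs Set_theory A B; x \<in> A\<rbrakk> \<Longrightarrow> app (cmp Set_theory g f) x = app g (app f x)"
  unfolding homs_def by (auto simp: app_def Set_theory_def compose_def)

lemma app_ident: "x \<in> A \<Longrightarrow> app (ident Set_theory A) x = x"
  by (simp add: app_def Set_theory_def)

lemma prodt_Set: "prodt Set_theory As = cart As"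
  by (simp add: Set_theory_def)

lemma app_proj: "x \<in> cart As \<Longrightarrow> app (proj Set_theory As i) x = untuple x ! i"
  by (simp add: app_def Set_theory_def)

definition mk_fun :: "'a univ set \<Rightarrow> 'a univ set \<Rightarrow> ('a univ \<Rightarrow> 'a univ) \<Rightarrow> 'a set_fun" where
  "mk_fun A B h = (A, B, \<lambda>x\<in>A. h x)"

lemma mk_fun_homs: "(\<And>x. x \<in> A \<Longrightarrow> h x \<in> B) \<Longrightarrow> mk_fun A B h \<in> homs Set_theory A B"
  by (auto simp: set_fun_homs_iff mk_fun_def)

lemma app_mk_fun: "x \<in> A \<Longrightarrow> app (mk_fun A B h) x = h x"
  by (simp add: app_def mk_fun_def)

text \<open>Since \<open>untuple\<close> sends an atom to \<open>[]\<close>, the equation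
  \<open>x = Tuple (untuple x)\<close> is what excludes atoms when \<open>As\<close> is
  empty.\<close>

lemma cart_iff:
  "x \<in> cart As \<longleftrightarrow> x = Tuple (untuple x) \<and> length (untuple x) = length As \<and>
    (\<forall>i < length As. untuple x ! i \<in> As ! i)"
  by (cases x) (auto simp: cart_def list_all2_conv_all_nth)

lemma cartE:
  assumes "x \<in> cart As"
  obtains xs where "x = Tuple xs" "length xs = length As"
    and "\<And>i. i < length As \<Longrightarrow> xs ! i \<in> As ! i"
  using assms by (auto simp: cart_def list_all2_conv_all_nth)

lemma cart_eqI:
  assumes "x \<in> cart As" "y \<in> cart As"
    and "\<And>i. i < length As \<Longrightarrow> untuple x ! i = untuple y ! i"
  shows "x = y"
  using assms by (metis cart_iff nth_equalityI)

lemma cart_Nil: "cart [] = {Tuple []}"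
  by (auto simp: cart_def)

lemma cart_pair: "cart [A, B] = {Tuple [a, b] |a b. a \<in> A \<and> b \<in> B}"
  by (auto simp: cart_def list_all2_Cons2)


section \<open>Terms of the generated theory\<close>

context decorated_theory
begin

lemma pure_homs: "f \<in> P \<Longrightarrow> f \<in> homs T (src T f) (tgt T f)"
  using pure_terms by (auto simp: homs_def)

lemma exp_class_eq: "exp_eq T P A B t u \<Longrightarrow> exp_class T P A B t = exp_class T P A B u"
  unfolding exp_class_def by (auto intro: exp_eq.trans exp_eq.sym)

text \<open>The class contains \<open>t\<close> by reflexivity, so the choice in
  \<open>exp_rep\<close> does pick a member.\<close>

lemma exp_rep_eq: "exp_wt T P A B t \<Longrightarrow> exp_eq T P A B t (exp_rep (exp_class T P A B t))"
  unfolding exp_rep_def exp_class_def by (auto intro: someI exp_eq.refl)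

lemma F_exp_homs_iff:
  "c \<in> homs (F_exp T P) A B \<longleftrightarrow> (\<exists>t. exp_wt T P A B t \<and> c = exp_class T P A B t)"
  by (auto simp: homs_def F_exp_def exp_class_def)

lemma types_F_exp: "types (F_exp T P) = exp_types T"
  by (simp add: F_exp_def)

lemma prodt_F_exp: "prodt (F_exp T P) = exp_prod T"
  by (simp add: F_exp_def)

text \<open>Composition in \<open>F_exp\<close> goes through chosen representatives;
  \<open>exp_eq.comp_cong\<close> makes the class of the result independent of the choice.\<close>

lemma cmp_exp_class:
  assumes "exp_wt T P A B t" "exp_wt T P B C u"
  shows "cmp (F_exp T P) (exp_class T P B C u) (exp_class T P A B t)
    = exp_class T P A C (EComp u t)"
proof -
  have "exp_class T P A C (EComp u t)
      = exp_class T P A C (EComp (exp_rep (exp_class T P B C u)) (exp_rep (exp_class T P A B t)))"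
    using assms by (blast intro: exp_class_eq exp_eq.comp_cong exp_rep_eq)
  then show ?thesis
    by (simp add: F_exp_def) (simp add: exp_class_def)
qed

text \<open>The image of a pure term under \<open>exp_incl\<close>, without the restriction to
  \<open>P\<close>.\<close>

definition exp_pure :: "'m \<Rightarrow> ('o, 'm) exp_term" where
  "exp_pure f = exp_class T P (Base (src T f)) (Base (tgt T f)) (EPure f)"

lemma exp_pure_homs: "f \<in> P \<Longrightarrow> exp_pure f \<in> homs (F_exp T P) (Base (src T f)) (Base (tgt T f))"
  unfolding F_exp_homs_iff exp_pure_def by (auto intro: exp_wt.pure)

lemma exp_prime_homs:
  "f \<in> homs T X Y \<Longrightarrow> exp_prime T P f \<in> homs (F_exp T P) (exp_prod T (dist_times X)) (Base Y)"
  unfolding F_exp_homs_iff exp_prime_def by (auto simp: homs_def intro: exp_wt.prime)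

lemma Base_types: "X \<in> types T \<Longrightarrow> Base X \<in> types (F_exp T P)"
  and Dist_types: "Dist \<in> types (F_exp T P)"
  by (auto simp: types_F_exp intro: exp_types.intros)

lemma dist_times_types: "X \<in> types T \<Longrightarrow> set (dist_times X) \<subseteq> types (F_exp T P)"
  by (auto simp: types_F_exp intro: exp_types.intros)

lemma exp_prod_Base: "exp_prod T (map Base Xs) = Base (prodt T Xs)"
  by (simp add: exp_prod_def list_all_iff comp_def)

end

text \<open>The theory axioms of \<open>F_exp T P\<close> are assumed at this stage; they are
  supplied later by a model, which is a morphism with this theory as source.\<close>

locale exp_theory = decorated_theory +
  assumes F_exp_theory: "equational_theory (F_exp T P)"
begin

sublocale E: equational_theory "F_exp T P"
  by (rule F_exp_theory)

lemma F_exp_types_induct [consumes 1, case_names base dist prod]: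
  assumes "A \<in> types (F_exp T P)"
    and "\<And>X. X \<in> types T \<Longrightarrow> Q (Base X)" and "Q Dist"
    and "\<And>As. set As \<subseteq> types (F_exp T P) \<Longrightarrow> (\<And>A. A \<in> set As \<Longrightarrow> Q A) \<Longrightarrow>
      Q (prodt (F_exp T P) As)"
  shows "Q A"
proof -
  have "A \<in> exp_types T"
    using assms(1) by (simp add: types_F_exp)
  then show ?thesis
  proof induction
    case (prod As)
    then have "set As \<subseteq> types (F_exp T P)"
      by (auto simp: types_F_exp)
    then show ?case
      using assms(4) prod by (simp add: prodt_F_exp)
  qed (use assms in auto)
qed

text \<open>The tuple case speaks of an arbitrary term into a product and of its composites with the
  projections. By \<open>proj_tuple\<close> these composites are the components of a tuple
  expression, so the rule follows from induction on \<open>exp_wt\<close> and can be applied without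
  a tuple operation on classes.\<close>

lemma F_exp_terms_induct [consumes 1, case_names pure prime ident cmp proj tuple]:
  assumes c: "c \<in> homs (F_exp T P) A B"
    and pure: "\<And>f. f \<in> P \<Longrightarrow> Q (exp_pure f)"
    and prime: "\<And>f. f \<in> terms T \<Longrightarrow> Q (exp_prime T P f)"
    and ident: "\<And>A. A \<in> types (F_exp T P) \<Longrightarrow> Q (ident (F_exp T P) A)"
    and cmp: "\<And>A B C c d. c \<in> homs (F_exp T P) A B \<Longrightarrow> d \<in> homs (F_exp T P) B C \<Longrightarrow> Q c \<Longrightarrow> Q d
      \<Longrightarrow> Q (cmp (F_exp T P) d c)"
    and proj: "\<And>As i. set As \<subseteq> types (F_exp T P) \<Longrightarrow> i < length As \<Longrightarrow> Q (proj (F_exp T P) As i)"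
    and tuple: "\<And>A Bs c. c \<in> homs (F_exp T P) A (prodt (F_exp T P) Bs) \<Longrightarrow>
      set Bs \<subseteq> types (F_exp T P) \<Longrightarrow>
      (\<And>i. i < length Bs \<Longrightarrow> Q (cmp (F_exp T P) (proj (F_exp T P) Bs i) c)) \<Longrightarrow> Q c"
  shows "Q c"
proof -
  have "exp_wt T P A B t \<Longrightarrow> Q (exp_class T P A B t)" for t
  proof (induction rule: exp_wt.induct)
    case (pure f)
    then show ?case
      using assms(2) by (simp add: exp_pure_def)
  next
    case (prime f)
    then show ?case
      using assms(3) by (simp add: exp_prime_def)
  next
    case (id A)
    then show ?case
      using ident[of A] by (simp add: F_exp_def)
  next
    case (comp A B t C u)
    then have "Q (cmp (F_exp T P) (exp_class T P B C u) (exp_class T P A B t))"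
      by (intro cmp) (auto simp: F_exp_homs_iff)
    then show ?case
      using comp cmp_exp_class by simp
  next
    case (proj As i)
    then show ?case
      using assms(6)[of As i] by (simp add: F_exp_def)
  next
    case (tuple A Bs ts)
    let ?c = "exp_class T P A (exp_prod T Bs) (ETuple A ts)"
    have wt: "exp_wt T P A (exp_prod T Bs) (ETuple A ts)"
      using tuple by (intro exp_wt.tuple)
    show ?case
    proof (rule assms(7))
      show "?c \<in> homs (F_exp T P) A (prodt (F_exp T P) Bs)"
        using wt by (auto simp: F_exp_homs_iff prodt_F_exp)
      show "set Bs \<subseteq> types (F_exp T P)"
        using tuple by (simp add: types_F_exp)
      fix i
      assume i: "i < length Bs"
      have "cmp (F_exp T P) (proj (F_exp T P) Bs i) ?c
          = exp_class T P A (Bs ! i) (EComp (EProj Bs i) (ETuple A ts))"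
        using cmp_exp_class[OF wt exp_wt.proj] tuple i by (simp add: F_exp_def)
      also have "\<dots> = exp_class T P A (Bs ! i) (ts ! i)"
        using tuple i by (intro exp_class_eq exp_eq.proj_tuple)
      finally show "Q (cmp (F_exp T P) (proj (F_exp T P) Bs i) ?c)"
        using tuple i by simp
    qed
  qed
  then show ?thesis
    using c by (auto simp: F_exp_homs_iff)
qed

text \<open>Uniqueness half of the universal property of the generated theory. At tuples it uses
  that a term of \<open>U\<close> into a product is fixed by its projections, and that both
  morphisms preserve these strictly.\<close>

lemma F_exp_morphism_eqI:
  assumes F: "thy_morphism (F_exp T P) U F" and G: "thy_morphism (F_exp T P) U G"
    and base: "\<And>X. X \<in> types T \<Longrightarrow> ty_map F (Base X) = ty_map G (Base X)"
    and dist: "ty_map F Dist = ty_map G Dist"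
    and pure: "\<And>f. f \<in> P \<Longrightarrow> tm_map F (exp_pure f) = tm_map G (exp_pure f)"
    and prime: "\<And>f. f \<in> terms T \<Longrightarrow> tm_map F (exp_prime T P f) = tm_map G (exp_prime T P f)"
  shows "F = G"
proof -
  interpret U: equational_theory U
    using F by (rule thy_morphism_target)
  have ty: "ty_map F A = ty_map G A" if "A \<in> types (F_exp T P)" for A
    using that
  proof (induction rule: F_exp_types_induct)
    case (prod As)
    then show ?case
      using ty_map_prodt[OF F prod(1)] ty_map_prodt[OF G prod(1)] by (simp cong: map_cong)
  qed (use base dist in auto)
  have tm: "tm_map F c = tm_map G c" if "c \<in> terms (F_exp T P)" for c
    using homs_self[OF that]
  proof (induction rule: F_exp_terms_induct)
    case (ident A)
    then show ?case
      using tm_map_ident[OF F] tm_map_ident[OF G] ty by simp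
  next
    case (cmp A B C c d)
    then show ?case
      using tm_map_cmp[OF F] tm_map_cmp[OF G] by metis
  next
    case (proj As i)
    then have "map (ty_map F) As = map (ty_map G) As"
      using ty by auto
    then show ?case
      using tm_map_proj[OF F proj] tm_map_proj[OF G proj] by (simp only:)
  next
    case (tuple A Bs c)
    have A: "A \<in> types (F_exp T P)"
      using tuple(1) by (rule E.homs_types)
    have Bs: "map (ty_map F) Bs = map (ty_map G) Bs"
      using ty tuple(2) by auto
    show ?case
    proof (rule U.hom_prodt_eqI)
      show "tm_map F c \<in> homs U (ty_map F A) (prodt U (map (ty_map F) Bs))"
        using tm_map_homs[OF F tuple(1)] ty_map_prodt[OF F tuple(2)] by simp
      show "tm_map G c \<in> homs U (ty_map F A) (prodt U (map (ty_map F) Bs))"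
        using tm_map_homs[OF G tuple(1)] ty_map_prodt[OF G tuple(2)] ty[OF A] Bs by (simp only:)
      show "set (map (ty_map F) Bs) \<subseteq> types U"
        using tuple(2) ty_map_types[OF F] by auto
      fix i
      assume "i < length (map (ty_map F) Bs)"
      then have i: "i < length Bs"
        by simp
      note cmp = tm_map_cmp[OF _ tuple(1) E.proj_homs[OF tuple(2) i]]
      show "cmp U (proj U (map (ty_map F) Bs) i) (tm_map F c)
          = cmp U (proj U (map (ty_map F) Bs) i) (tm_map G c)"
        using tuple(3)[OF i] cmp[OF F] cmp[OF G] tm_map_proj[OF F tuple(2) i]
          tm_map_proj[OF G tuple(2) i] Bs by (simp only:)
    qed
  qed (use pure prime in auto)
  show ?thesis
    using F G ty tm by (rule thy_map_eqI)
qed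

end


section \<open>The morphism to the decorated theory\<close>

text \<open>Together with \<open>exp_tm\<close> this interprets the syntax of the generated theory
  in \<open>T\<close>: it is \<open>exp_theta\<close> before passing to classes.\<close>

primrec exp_ty :: "('o, 'm) eqn_theory \<Rightarrow> 'o exp_type \<Rightarrow> 'o" where
  "exp_ty T (Base X) = X"
| "exp_ty T Dist = prodt T []"
| "exp_ty T (Prod As) = prodt T (map (exp_ty T) As)"

primrec exp_tm :: "('o, 'm) eqn_theory \<Rightarrow> ('o, 'm) exp_expr \<Rightarrow> 'm" where
  "exp_tm T (EPure f) = f"
| "exp_tm T (EPrime f) = cmp T f (proj T [prodt T [], src T f] 1)"
| "exp_tm T (EId A) = ident T (exp_ty T A)"
| "exp_tm T (EComp u t) = cmp T (exp_tm T u) (exp_tm T t)"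
| "exp_tm T (EProj As i) = proj T (map (exp_ty T) As) i"
| "exp_tm T (ETuple A ts) = tuple T (exp_ty T A) (map (exp_tm T) ts)"

text \<open>A collapsed product of base types gets the same interpretation as a free product would,
  so strict preservation of products can be proved without distinguishing the two.\<close>

lemma exp_ty_exp_prod: "exp_ty T (exp_prod T As) = prodt T (map (exp_ty T) As)"
proof (cases "list_all is_Base As")
  case True
  then have "exp_ty T A = un_Base A" if "A \<in> set As" for A
    using that by (auto simp: list_all_iff is_Base_def)
  then show ?thesis
    using True by (simp add: exp_prod_def cong: map_cong)
qed (simp add: exp_prod_def)

section \<open>Soundness of the interpretation of expressions\<close>

context decorated_theory
begin

lemma exp_ty_types: "A \<in> exp_types T \<Longrightarrow> exp_ty T A \<in> types T"
proof (induction rule: exp_types.induct)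
  case (prod As)
  then have "set (map (exp_ty T) As) \<subseteq> types T"
    by auto
  then show ?case
    unfolding exp_ty_exp_prod by (rule prodt_types)
qed (auto intro: prodt_types)

lemma map_exp_ty_types: "set As \<subseteq> exp_types T \<Longrightarrow> set (map (exp_ty T) As) \<subseteq> types T"
  using exp_ty_types by auto

lemma snd_proj_homs:
  assumes "X \<in> types T" "Y \<in> types T"
  shows "proj T [Y, X] 1 \<in> homs T (prodt T [Y, X]) X"
  using proj_homs[of "[Y, X]" 1] assms by simp

lemma terminal_types: "prodt T [] \<in> types T"
  using prodt_types[of "[]"] by simp

lemma exp_ty_dist_times: "exp_ty T (exp_prod T (dist_times X)) = prodt T [prodt T [], X]"
  by (simp add: exp_ty_exp_prod)

lemma exp_tm_homs: "exp_wt T P A B t \<Longrightarrow> exp_tm T t \<in> homs T (exp_ty T A) (exp_ty T B)"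
proof (induction rule: exp_wt.induct)
  case (pure f)
  then show ?case
    using pure_homs by simp
next
  case (prime f)
  then show ?case
    using cmp_homs[OF snd_proj_homs homs_self] src_types terminal_types
    by (simp add: exp_ty_dist_times)
next
  case (id A)
  then show ?case
    using ident_homs exp_ty_types by simp
next
  case (comp A B t C u)
  then show ?case
    using cmp_homs by simp
next
  case (proj As i)
  then show ?case
    using proj_homs[OF map_exp_ty_types, of As i] by (simp add: exp_ty_exp_prod)
next
  case (tuple A Bs ts)
  then show ?case
    using tuple_homs[OF exp_ty_types map_exp_ty_types, of A Bs "map (exp_tm T) ts"]
    by (simp add: exp_ty_exp_prod)
qed

text \<open>Each generating equation holds in \<open>T\<close> when \<open>f'\<close> is read as
  \<open>f\<close> after the second projection of \<open>1 \<times> X\<close>. Under this reading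
  \<open>prime_pure\<close> is literal; the work lies in \<open>prime_comp\<close> and
  \<open>prime_tuple\<close>.\<close>

lemma exp_tm_cong: "exp_eq T P A B t u \<Longrightarrow> exp_tm T t = exp_tm T u"
proof (induction rule: exp_eq.induct)
  case (tuple_cong A Bs ts ts')
  then have "map (exp_tm T) ts = map (exp_tm T) ts'"
    by (intro nth_equalityI) auto
  then show ?case
    by (simp only: exp_tm.simps)
next
  case (id_left A B t)
  then show ?case
    using ident_left[OF exp_tm_homs] by simp
next
  case (id_right A B t)
  then show ?case
    using ident_right[OF exp_tm_homs] by simp
next
  case (assoc A B t C u D v)
  then show ?case
    using cmp_assoc[OF assoc[THEN exp_tm_homs]] by simp
next
  case (proj_tuple A Bs ts j)
  then show ?case
    using cmp_proj_tuple[OF exp_ty_types map_exp_ty_types,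
        of A Bs "map (exp_tm T) ts" j]
      exp_tm_homs by simp
next
  case (tuple_proj Bs A t)
  let ?ts = "map (\<lambda>i. cmp T (proj T (map (exp_ty T) Bs) i) (exp_tm T t)) [0..<length Bs]"
  have t: "exp_tm T t \<in> homs T (exp_ty T A) (prodt T (map (exp_ty T) Bs))"
    using exp_tm_homs[OF tuple_proj(2)] by (simp add: exp_ty_exp_prod)
  have "cmp T (proj T (map (exp_ty T) Bs) i) (exp_tm T t)
      \<in> homs T (exp_ty T A) (map (exp_ty T) Bs ! i)" if "i < length Bs" for i
    using cmp_homs[OF t proj_homs] map_exp_ty_types[OF tuple_proj(1)] that by simp
  then have "exp_tm T t = tuple T (exp_ty T A) ?ts"
    using t map_exp_ty_types[OF tuple_proj(1)] by (intro eq_tupleI) auto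
  then show ?case
    by (simp add: comp_def)
next
  case (pure_proj Xs i)
  then show ?case
    by (simp add: comp_def)
next
  case (prime_comp f g)
  let ?Ys = "[prodt T [], src T f]" and ?X = "prodt T [prodt T [], src T f]"
  let ?Zs = "[prodt T [], tgt T f]"
  have Ys: "set ?Ys \<subseteq> types T" and Zs: "set ?Zs \<subseteq> types T"
    using prime_comp src_types tgt_types terminal_types by auto
  note f = homs_self[OF prime_comp(1)] and g = homs_self[OF prime_comp(2), folded prime_comp(3)]
  have p: "proj T ?Ys 0 \<in> homs T ?X (prodt T [])" "proj T ?Ys 1 \<in> homs T ?X (src T f)"
    using proj_homs[OF Ys, of 0] proj_homs[OF Ys, of 1] by auto
  have q: "proj T ?Zs 1 \<in> homs T (prodt T ?Zs) (tgt T f)"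
    using proj_homs[OF Zs, of 1] by auto
  let ?fs = "[proj T ?Ys 0, cmp T f (proj T ?Ys 1)]"
  have fs: "?fs ! i \<in> homs T ?X (?Zs ! i)" if "i < length ?Zs" for i
    using that p(1) cmp_homs[OF p(2) f] by (cases i) auto
  have X: "?X \<in> types T"
    using Ys by (rule prodt_types)
  have h: "tuple T ?X ?fs \<in> homs T ?X (prodt T ?Zs)"
    by (rule tuple_homs[OF X Zs _ fs]) auto
  have "cmp T (proj T ?Zs 1) (tuple T ?X ?fs) = cmp T f (proj T ?Ys 1)"
    using cmp_proj_tuple[OF X Zs _ fs, of 1] by simp
  \<comment> \<open>By associativity both sides are \<open>g\<close> after \<open>f\<close> after
    the second projection from \<open>?X\<close>.\<close>
  then have "cmp T (cmp T g (proj T ?Zs 1)) (tuple T ?X ?fs) = cmp T (cmp T g f) (proj T ?Ys 1)"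
    using cmp_assoc[OF h q g] cmp_assoc[OF p(2) f g] by simp
  then show ?case
    using prime_comp(3) homs_src[OF cmp_homs[OF f g]] by (simp add: exp_ty_dist_times)
next
  case (prime_tuple X fs)
  let ?Ys = "map (tgt T) fs" and ?Z = "prodt T [prodt T [], X]"
  let ?p = "proj T [prodt T [], X] 1"
  have Ys: "set ?Ys \<subseteq> types T"
    using prime_tuple tgt_types by auto
  have fs: "fs ! i \<in> homs T X (?Ys ! i)" if "i < length ?Ys" for i
    using prime_tuple(2,3) that nth_mem[of i fs] by (auto simp: homs_def)
  have p: "?p \<in> homs T ?Z X"
    using snd_proj_homs[OF prime_tuple(1) terminal_types] .
  have h: "tuple T X fs \<in> homs T X (prodt T ?Ys)"
    by (rule tuple_homs[OF prime_tuple(1) Ys _ fs]) auto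
  have "exp_tm T (EPrime (tuple T X fs)) = cmp T (tuple T X fs) ?p"
    using homs_src[OF h] by simp
  \<comment> \<open>Tupling commutes with precomposition, since both sides have the same
    components.\<close>
  also have "\<dots> = tuple T ?Z (map (\<lambda>f. cmp T f ?p) fs)"
  proof (rule eq_tupleI)
    show "cmp T (tuple T X fs) ?p \<in> homs T ?Z (prodt T ?Ys)"
      using p h by (rule cmp_homs)
  next
    fix i
    assume i: "i < length ?Ys"
    show "map (\<lambda>f. cmp T f ?p) fs ! i \<in> homs T ?Z (?Ys ! i)"
      using cmp_homs[OF p fs[OF i]] i by simp
    show "cmp T (proj T ?Ys i) (cmp T (tuple T X fs) ?p) = map (\<lambda>f. cmp T f ?p) fs ! i"
      using cmp_assoc[OF p h proj_homs[OF Ys i]] i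
        cmp_proj_tuple[OF prime_tuple(1) Ys _ fs i] by simp
  qed (use Ys in auto)
  also have "\<dots> = exp_tm T (ETuple (exp_prod T (dist_times X)) (map EPrime fs))"
    using prime_tuple(3)
    by (auto simp: exp_ty_dist_times comp_def intro!: arg_cong[of _ _ "tuple T ?Z"])
  finally show ?case .
qed auto

text \<open>Soundness makes the interpretation independent of the representative, hence a function
  on classes.\<close>

lemma exp_tm_exp_rep: "exp_wt T P A B t \<Longrightarrow> exp_tm T (exp_rep (exp_class T P A B t)) = exp_tm T t"
  using exp_tm_cong[OF exp_rep_eq] by simp

end

section \<open>Existence and uniqueness of \<open>exp_theta\<close>\<close>

context exp_theory
begin

lemma pure_comp_exp_incl_eq_iff:
  "thy_comp (pure_theory T P) F (exp_incl T P) = thy_comp (pure_theory T P) G H \<longleftrightarrow>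
    (\<forall>X \<in> types T. ty_map F (Base X) = ty_map G (ty_map H X)) \<and>
    (\<forall>f \<in> P. tm_map F (exp_pure f) = tm_map G (tm_map H f))"
  by (auto simp: thy_comp_def pure_theory_def exp_incl_def exp_pure_def compose_def fun_eq_iff
      restrict_def)

lemma pure_comp_exp_incl_eq_incl_iff:
  "thy_comp (pure_theory T P) F (exp_incl T P) = pure_incl T P \<longleftrightarrow>
    (\<forall>X \<in> types T. ty_map F (Base X) = X) \<and> (\<forall>f \<in> P. tm_map F (exp_pure f) = f)"
  by (auto simp: thy_comp_def pure_theory_def exp_incl_def exp_pure_def compose_def fun_eq_iff
      restrict_def pure_incl_def)

lemma is_exp_theta_exists: "\<exists>F. is_exp_theta T P F"
proof
  \<comment> \<open>The term part reads the chosen representative of a class; \<open>tm\<close>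
    below replaces it by whichever expression presents the class.\<close>
  define F where "F = \<lparr>ty_map = \<lambda>A\<in>exp_types T. exp_ty T A,
    tm_map = \<lambda>c\<in>terms (F_exp T P). exp_tm T (exp_rep c)\<rparr>"
  have ty: "ty_map F A = exp_ty T A" if "A \<in> types (F_exp T P)" for A
    using that by (simp add: F_def types_F_exp)
  have tm: "tm_map F (exp_class T P A B t) = exp_tm T t" if "exp_wt T P A B t" for A B t
  proof -
    have "exp_class T P A B t \<in> homs (F_exp T P) A B"
      using that by (auto simp: F_exp_homs_iff)
    then show ?thesis
      using that by (simp add: F_def exp_tm_exp_rep homs_terms)
  qed
  have homs: "tm_map F c \<in> homs T (ty_map F (src (F_exp T P) c)) (ty_map F (tgt (F_exp T P) c))"
    if c: "c \<in> terms (F_exp T P)" for c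
  proof -
    obtain t where t: "exp_wt T P (src (F_exp T P) c) (tgt (F_exp T P) c) t"
      "c = exp_class T P (src (F_exp T P) c) (tgt (F_exp T P) c) t"
      using homs_self[OF c] unfolding F_exp_homs_iff by auto
    then have "tm_map F c = exp_tm T t"
      using tm by metis
    moreover have "src (F_exp T P) c \<in> types (F_exp T P)" "tgt (F_exp T P) c \<in> types (F_exp T P)"
      using E.src_types E.tgt_types c by auto
    ultimately show ?thesis
      using exp_tm_homs[OF t(1)] by (simp add: ty)
  qed
  have ident: "tm_map F (ident (F_exp T P) A) = ident T (ty_map F A)"
    if "A \<in> types (F_exp T P)" for A
    using that tm[OF exp_wt.id, of A] by (simp add: ty types_F_exp) (simp add: F_exp_def)
  have cmp: "tm_map F (cmp (F_exp T P) d c) = cmp T (tm_map F d) (tm_map F c)"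
    if cd: "c \<in> terms (F_exp T P)" "d \<in> terms (F_exp T P)"
      "tgt (F_exp T P) c = src (F_exp T P) d"
    for c d
  proof -
    obtain A B C t u where *: "exp_wt T P A B t" "c = exp_class T P A B t"
      "exp_wt T P B C u" "d = exp_class T P B C u"
      using homs_self[OF cd(1)] homs_self[OF cd(2)] cd(3) unfolding F_exp_homs_iff by auto
    then have "exp_wt T P A C (EComp u t)"
      by (blast intro: exp_wt.comp)
    then show ?thesis
      using tm * by (simp add: cmp_exp_class)
  qed
  have map_eq: "map (ty_map F) As = map (exp_ty T) As" if "set As \<subseteq> types (F_exp T P)" for As
    using that ty by auto
  have prodt: "ty_map F (prodt (F_exp T P) As) = prodt T (map (ty_map F) As)"
    if "set As \<subseteq> types (F_exp T P)" for As
    using ty[OF E.prodt_types[OF that]] unfolding map_eq[OF that] prodt_F_exp exp_ty_exp_prod .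
  have proj: "tm_map F (proj (F_exp T P) As i) = proj T (map (ty_map F) As) i"
    if "set As \<subseteq> types (F_exp T P)" "i < length As" for As i
    using tm[OF exp_wt.proj, of As i] that unfolding map_eq[OF that(1)]
    by (simp add: types_F_exp) (simp add: F_exp_def)
  have "thy_morphism (F_exp T P) T F"
    unfolding thy_morphism_def
    using homs ident cmp prodt proj ty exp_ty_types equational_theory_axioms F_exp_theory
    by (auto simp: homs_def types_F_exp) (auto simp: F_def)
  moreover have "tm_map F (exp_prime T P f) = cmp T f (proj T [prodt T [], src T f] 1)"
    if "f \<in> terms T" for f
    unfolding exp_prime_def using tm[OF exp_wt.prime[OF that]] by simp
  moreover have "tm_map F (exp_pure f) = f" if "f \<in> P" for f
    unfolding exp_pure_def using tm[OF exp_wt.pure[OF that]] by simp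
  ultimately show "is_exp_theta T P F"
    using ty Base_types Dist_types by (auto simp: is_exp_theta_def pure_comp_exp_incl_eq_incl_iff)
qed

text \<open>Two candidates agree on the generators, hence everywhere, so the definite description
  \<open>exp_theta\<close> denotes.\<close>

lemma is_exp_theta_exp_theta: "is_exp_theta T P (exp_theta T P)"
proof -
  have "F = G" if "is_exp_theta T P F" "is_exp_theta T P G" for F G
    using that unfolding is_exp_theta_def pure_comp_exp_incl_eq_incl_iff
    by (intro F_exp_morphism_eqI[of T F G]) auto
  then show ?thesis
    unfolding exp_theta_def using is_exp_theta_exists by (metis theI)
qed

lemma
  shows exp_theta_morphism: "thy_morphism (F_exp T P) T (exp_theta T P)"
    and exp_theta_Base: "X \<in> types T \<Longrightarrow> ty_map (exp_theta T P) (Base X) = X"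
    and exp_theta_Dist: "ty_map (exp_theta T P) Dist = prodt T []"
    and exp_theta_pure: "f \<in> P \<Longrightarrow> tm_map (exp_theta T P) (exp_pure f) = f"
    and exp_theta_prime: "f \<in> terms T \<Longrightarrow>
      tm_map (exp_theta T P) (exp_prime T P f) = cmp T f (proj T [prodt T [], src T f] 1)"
  using is_exp_theta_exp_theta by (auto simp: is_exp_theta_def pure_comp_exp_incl_eq_incl_iff)

end


section \<open>Models of the generated theory\<close>

lemma
  assumes "nat_trans S T F G m"
  shows nat_trans_homs: "X \<in> types S \<Longrightarrow> m X \<in> homs T (ty_map F X) (ty_map G X)"
    and nat_trans_eq: "f \<in> homs S X Y \<Longrightarrow>
      cmp T (m Y) (tm_map F f) = cmp T (tm_map G f) (m X)"
    and nat_trans_extensional: "m \<in> extensional (types S)"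
  using assms by (auto simp: nat_trans_def homs_def)

lemma cmp_set_fun_eqD:
  assumes "cmp Set_theory g f = cmp Set_theory k h"
    and "f \<in> homs Set_theory A B" "h \<in> homs Set_theory A C" "x \<in> A"
  shows "app g (app f x) = app k (app h x)"
  using assms app_cmp by metis

text \<open>The component at a type of the morphism determined by the value \<open>\<alpha>\<close> at \<open>Dist\<close>.\<close>

primrec subst_dist :: "'a univ \<Rightarrow> 'o exp_type \<Rightarrow> 'a univ \<Rightarrow> 'a univ" where
  "subst_dist \<alpha> (Base X) x = x"
| "subst_dist \<alpha> Dist x = \<alpha>"
| "subst_dist \<alpha> (Prod As) x = Tuple (map2 (\<lambda>h y. h y) (map (subst_dist \<alpha>) As) (untuple x))"

text \<open>The clause for \<open>Prod\<close> in \<open>subst_dist\<close> applies a list of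
  functions, as primitive recursion through lists requires. This is the uniform componentwise
  formula; it covers collapsed products too, because the substitution does nothing at base
  types.\<close>

lemma subst_dist_exp_prod:
  assumes "length xs = length As"
  shows "subst_dist \<alpha> (exp_prod T As) (Tuple xs) = Tuple (map2 (subst_dist \<alpha>) As xs)"
proof (cases "list_all is_Base As")
  case True
  then have "map2 (subst_dist \<alpha>) As xs = xs"
    using assms by (intro nth_equalityI) (auto simp: list_all_length is_Base_def)
  then show ?thesis
    using True by (simp add: exp_prod_def)
next
  case False
  have "map2 (\<lambda>h y. h y) (map (subst_dist \<alpha>) As) xs = map2 (subst_dist \<alpha>) As xs"
    using assms by (intro nth_equalityI) auto
  then show ?thesis
    using False by (simp add: exp_prod_def)
qed

locale exp_model = decorated_theory T P
  for T :: "('o, 'm) eqn_theory" and P :: "'m set" +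
  fixes MA :: "('o exp_type, ('o, 'm) exp_term, 'a) thy_model"
  assumes MA_model: "model (F_exp T P) MA"
begin

lemma MA: "thy_morphism (F_exp T P) Set_theory MA"
  using MA_model by (simp add: model_def)

text \<open>\<open>thy_morphism\<close> records that both of its ends are theories, so
  \<open>MA\<close> supplies the theory axioms for \<open>F_exp T P\<close> here and for
  \<open>Set_theory\<close> below.\<close>

sublocale exp_theory T P
  by (intro exp_theory.intro decorated_theory_axioms exp_theory_axioms.intro
      thy_morphism_source[OF MA])

sublocale Sets: equational_theory "Set_theory :: ('a univ set, 'a set_fun) eqn_theory"
  using MA by (rule thy_morphism_target)

abbreviation \<theta> :: "('o exp_type, ('o, 'm) exp_term, 'o, 'm) thy_map" where
  "\<theta> \<equiv> exp_theta T P"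

section \<open>Evaluating the model at products and at the terms \<open>f'\<close>\<close>

lemma MA_prodt:
  "set As \<subseteq> types (F_exp T P) \<Longrightarrow> ty_map MA (exp_prod T As) = cart (map (ty_map MA) As)"
  using ty_map_prodt[OF MA] by (simp add: prodt_F_exp prodt_Set)

lemma MA_proj:
  assumes "set As \<subseteq> types (F_exp T P)" "i < length As" "x \<in> cart (map (ty_map MA) As)"
  shows "app (tm_map MA (proj (F_exp T P) As i)) x = untuple x ! i"
  using tm_map_proj[OF MA assms(1,2)] assms(3) by (simp add: app_proj)

lemma MA_dist_times:
  assumes "X \<in> types T"
  shows "ty_map MA (exp_prod T (dist_times X)) = cart [ty_map MA Dist, ty_map MA (Base X)]"
  using MA_prodt[OF dist_times_types[OF assms]] by simp

lemma MA_prime_homs: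
  assumes "f \<in> homs T X Y"
  shows "tm_map MA (exp_prime T P f)
    \<in> homs Set_theory (cart [ty_map MA Dist, ty_map MA (Base X)]) (ty_map MA (Base Y))"
  using tm_map_homs[OF MA exp_prime_homs[OF assms]] MA_dist_times homs_types[OF assms] by simp

lemma exp_prime_pure:
  assumes "f \<in> P"
  shows "exp_prime T P f
    = cmp (F_exp T P) (exp_pure f) (proj (F_exp T P) (dist_times (src T f)) 1)"
proof -
  have X: "src T f \<in> types T"
    using assms pure_terms src_types by auto
  have "exp_prime T P f = exp_class T P (exp_prod T (dist_times (src T f))) (Base (tgt T f))
      (EComp (EPure f) (EProj (dist_times (src T f)) 1))"
    unfolding exp_prime_def using assms by (intro exp_class_eq exp_eq.prime_pure)
  also have "\<dots> = cmp (F_exp T P) (exp_pure f)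
      (exp_class T P (exp_prod T (dist_times (src T f))) (Base (src T f))
        (EProj (dist_times (src T f)) 1))"
    using assms X exp_wt.proj[of "dist_times (src T f)" T 1 P] exp_wt.pure[OF assms, of T]
      dist_times_types[OF X]
    by (simp add: cmp_exp_class exp_pure_def types_F_exp)
  finally show ?thesis
    by (simp add: F_exp_def)
qed

text \<open>Here \<open>h\<close> is the pairing of the projection to \<open>Dist\<close> with
  \<open>f'\<close>. It is exposed only through its two projections, since these are what can be
  evaluated in a model.\<close>

lemma exp_prime_cmp:
  assumes f: "f \<in> homs T X Y" and g: "g \<in> homs T Y Z"
  shows "\<exists>h \<in> homs (F_exp T P) (exp_prod T (dist_times X)) (exp_prod T (dist_times Y)).
    exp_prime T P (cmp T g f) = cmp (F_exp T P) (exp_prime T P g) h \<and>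
    cmp (F_exp T P) (proj (F_exp T P) (dist_times Y) 0) h = proj (F_exp T P) (dist_times X) 0 \<and>
    cmp (F_exp T P) (proj (F_exp T P) (dist_times Y) 1) h = exp_prime T P f"
proof -
  let ?A = "exp_prod T (dist_times X)"
  let ?ts = "[EProj (dist_times X) 0, EPrime f]"
  let ?h = "exp_class T P ?A (exp_prod T (dist_times Y)) (ETuple ?A ?ts)"
  note XY = homs_types[OF f]
  have types: "set (dist_times X) \<subseteq> exp_types T" "set (dist_times Y) \<subseteq> exp_types T"
      "?A \<in> exp_types T"
    using dist_times_types XY E.prodt_types[of "dist_times X"]
    by (auto simp: types_F_exp prodt_F_exp)
  have f': "exp_wt T P ?A (Base Y) (EPrime f)"
    and g': "exp_wt T P (exp_prod T (dist_times Y)) (Base Z) (EPrime g)"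
    using exp_wt.prime[of f T P] exp_wt.prime[of g T P] f g by (auto simp: homs_def)
  have ts: "exp_wt T P ?A (dist_times Y ! i) (?ts ! i)" if "i < length (dist_times Y)" for i
    using that f' exp_wt.proj[OF types(1), of 0 P] by (cases i) auto
  have h: "exp_wt T P ?A (exp_prod T (dist_times Y)) (ETuple ?A ?ts)"
    using types ts by (intro exp_wt.tuple) auto
  have proj: "cmp (F_exp T P) (proj (F_exp T P) (dist_times Y) i) ?h
      = exp_class T P ?A (dist_times Y ! i) (?ts ! i)" if "i < length (dist_times Y)" for i
    using cmp_exp_class[OF h exp_wt.proj[OF types(2) that]]
      exp_class_eq[OF exp_eq.proj_tuple[OF types(3,2) _ ts that]]
    by (simp add: F_exp_def)
  have "exp_prime T P (cmp T g f) = exp_class T P ?A (Base Z) (EPrime (cmp T g f))"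
    using cmp_homs[OF f g] by (simp add: exp_prime_def homs_def)
  also have "\<dots> = exp_class T P ?A (Base Z) (EComp (EPrime g) (ETuple ?A ?ts))"
    using exp_class_eq[OF exp_eq.prime_comp, of f g] f g by (simp add: homs_def)
  also have "\<dots> = cmp (F_exp T P) (exp_prime T P g) ?h"
    using cmp_exp_class[OF h g'] g by (simp add: exp_prime_def homs_def)
  finally have "exp_prime T P (cmp T g f) = cmp (F_exp T P) (exp_prime T P g) ?h" .
  moreover have "?h \<in> homs (F_exp T P) ?A (exp_prod T (dist_times Y))"
    using h by (auto simp: F_exp_homs_iff)
  moreover have "cmp (F_exp T P) (proj (F_exp T P) (dist_times Y) 0) ?h
      = proj (F_exp T P) (dist_times X) 0"
    using proj[of 0] by (simp add: F_exp_def)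
  moreover have "cmp (F_exp T P) (proj (F_exp T P) (dist_times Y) 1) ?h = exp_prime T P f"
    using proj[of 1] f by (simp add: exp_prime_def homs_def)
  ultimately show ?thesis
    by blast
qed

text \<open>For pure \<open>f\<close> the generator \<open>f'\<close> factors through the second
  projection, so \<alpha> drops out. This is what puts the model built from \<alpha> over the pure
  part.\<close>

lemma MA_prime_pure:
  assumes f: "f \<in> P" and \<alpha>: "\<alpha> \<in> ty_map MA Dist" and x: "x \<in> ty_map MA (Base (src T f))"
  shows "app (tm_map MA (exp_prime T P f)) (Tuple [\<alpha>, x]) = app (tm_map MA (exp_pure f)) x"
proof -
  let ?X = "src T f"
  have X: "?X \<in> types T"
    using f pure_terms src_types by auto
  note As = dist_times_types[OF X]
  have p: "proj (F_exp T P) (dist_times ?X) 1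
      \<in> homs (F_exp T P) (exp_prod T (dist_times ?X)) (Base ?X)"
    using E.proj_homs[OF As, of 1] by (simp add: prodt_F_exp)
  have ax: "Tuple [\<alpha>, x] \<in> cart [ty_map MA Dist, ty_map MA (Base ?X)]"
    using \<alpha> x by (auto simp: cart_pair)
  have "app (tm_map MA (exp_prime T P f)) (Tuple [\<alpha>, x])
      = app (tm_map MA (exp_pure f))
          (app (tm_map MA (proj (F_exp T P) (dist_times ?X) 1)) (Tuple [\<alpha>, x]))"
    unfolding exp_prime_pure[OF f] tm_map_cmp[OF MA p exp_pure_homs[OF f]]
    using tm_map_homs[OF MA p] ax MA_dist_times[OF X] by (simp add: app_cmp)
  also have "app (tm_map MA (proj (F_exp T P) (dist_times ?X) 1)) (Tuple [\<alpha>, x]) = x"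
    using MA_proj[OF As, of 1 "Tuple [\<alpha>, x]"] ax by simp
  finally show ?thesis .
qed

text \<open>The pairing \<open>h\<close> sends \<open>(\<alpha>, x)\<close> to
  \<open>(\<alpha>, f'(\<alpha>, x))\<close>: both factors of a composite see the same \<alpha>, so
  fixing the first argument is compatible with composition.\<close>

lemma MA_prime_cmp:
  assumes f: "f \<in> homs T X Y" and g: "g \<in> homs T Y Z"
    and \<alpha>: "\<alpha> \<in> ty_map MA Dist" and x: "x \<in> ty_map MA (Base X)"
  shows "app (tm_map MA (exp_prime T P (cmp T g f))) (Tuple [\<alpha>, x])
    = app (tm_map MA (exp_prime T P g))
        (Tuple [\<alpha>, app (tm_map MA (exp_prime T P f)) (Tuple [\<alpha>, x])])"
proof -
  obtain h where h: "h \<in> homs (F_exp T P) (exp_prod T (dist_times X)) (exp_prod T (dist_times Y))"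
    and gf: "exp_prime T P (cmp T g f) = cmp (F_exp T P) (exp_prime T P g) h"
    and h0: "cmp (F_exp T P) (proj (F_exp T P) (dist_times Y) 0) h
      = proj (F_exp T P) (dist_times X) 0"
    and h1: "cmp (F_exp T P) (proj (F_exp T P) (dist_times Y) 1) h = exp_prime T P f"
    using exp_prime_cmp[OF f g] by blast
  note XY = homs_types[OF f]
  let ?ax = "Tuple [\<alpha>, x]" and ?h = "app (tm_map MA h)"
  have ax: "?ax \<in> cart [ty_map MA Dist, ty_map MA (Base X)]"
    using \<alpha> x by (auto simp: cart_pair)
  have hs: "tm_map MA h \<in> homs Set_theory (cart [ty_map MA Dist, ty_map MA (Base X)])
      (cart [ty_map MA Dist, ty_map MA (Base Y)])"
    using tm_map_homs[OF MA h] MA_dist_times XY by simp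
  have hax: "?h ?ax \<in> cart [ty_map MA Dist, ty_map MA (Base Y)]"
    using hs ax by (rule app_mem)
  have proj: "untuple (?h ?ax) ! i
      = app (tm_map MA (cmp (F_exp T P) (proj (F_exp T P) (dist_times Y) i) h)) ?ax"
    if "i < 2" for i
  proof -
    have "proj (F_exp T P) (dist_times Y) i
        \<in> homs (F_exp T P) (exp_prod T (dist_times Y)) (dist_times Y ! i)"
      using E.proj_homs[OF dist_times_types[OF XY(2)], of i] that by (simp add: prodt_F_exp)
    from tm_map_cmp[OF MA h this] show ?thesis
      using MA_proj[OF dist_times_types[OF XY(2)], of i "?h ?ax"] that hax
      by (simp add: app_cmp[OF hs ax])
  qed
  have "untuple (?h ?ax) ! 0 = \<alpha>"
    using proj[of 0] h0 MA_proj[OF dist_times_types[OF XY(1)], of 0 ?ax] ax by simp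
  moreover have "untuple (?h ?ax) ! 1 = app (tm_map MA (exp_prime T P f)) ?ax"
    using proj[of 1] h1 by simp
  ultimately have "?h ?ax = Tuple [\<alpha>, app (tm_map MA (exp_prime T P f)) ?ax]"
    using hax by (auto simp: cart_pair)
  moreover have "app (tm_map MA (exp_prime T P (cmp T g f))) ?ax
      = app (tm_map MA (exp_prime T P g)) (?h ?ax)"
    using tm_map_cmp[OF MA h exp_prime_homs[OF g]] gf by (simp add: app_cmp[OF hs ax])
  ultimately show ?thesis
    by simp
qed

section \<open>Models over the pure part\<close>

lemma is_model0_iff:
  "is_model0 T P MA M \<longleftrightarrow> thy_morphism T Set_theory M \<and>
    (\<forall>X \<in> types T. ty_map M X = ty_map MA (Base X)) \<and>
    (\<forall>f \<in> P. tm_map M f = tm_map MA (exp_pure f))"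
  by (auto simp: is_model0_def model_over_def model_def restr0_def pull_model_def thy_comp_def
      pure_theory_def pure_incl_def exp_incl_def exp_pure_def compose_def fun_eq_iff restrict_def)

text \<open>Both models restrict to the same pure model: \<open>MA\<close> by the definition of
  \<open>restr0\<close>, and the pullback of \<open>M\<close> because \<theta> is the identity on
  base types and pure terms. Only naturality and the condition at base types remain.\<close>

lemma is_mor0_iff:
  assumes M: "is_model0 T P MA M"
  shows "is_mor0 T P MA M m \<longleftrightarrow>
    nat_trans (F_exp T P) Set_theory (thy_comp (F_exp T P) M \<theta>) MA m \<and>
    (\<forall>X \<in> types T. m (Base X) = ident Set_theory (ty_map MA (Base X)))"
proof -
  have M': "thy_morphism T Set_theory M" "\<And>X. X \<in> types T \<Longrightarrow> ty_map M X = ty_map MA (Base X)"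
      "\<And>f. f \<in> P \<Longrightarrow> tm_map M f = tm_map MA (exp_pure f)"
    using M by (auto simp: is_model0_iff)
  let ?N = "thy_comp (F_exp T P) M \<theta>"
  have N: "thy_morphism (F_exp T P) Set_theory ?N"
    using exp_theta_morphism M'(1) by (rule thy_morphism_comp)
  have "ty_map ?N (Base X) = ty_map MA (Base X)" if "X \<in> types T" for X
    using that M'(2) Base_types exp_theta_Base by (simp add: thy_comp_def compose_def)
  moreover have "tm_map ?N (exp_pure f) = tm_map MA (exp_pure f)" if "f \<in> P" for f
    using that M'(3) homs_terms[OF exp_pure_homs[OF that]] exp_theta_pure[OF that]
    by (simp add: thy_comp_def compose_def)
  ultimately have "model_over (pure_theory T P) (F_exp T P) (exp_incl T P) (restr0 T P MA) ?N"
    using N unfolding model_over_def model_def restr0_def pull_model_def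
      pure_comp_exp_incl_eq_iff
    by (auto simp: exp_incl_def exp_pure_def)
  moreover have "model_over (pure_theory T P) (F_exp T P) (exp_incl T P) (restr0 T P MA) MA"
    using MA_model by (simp add: model_over_def restr0_def)
  moreover have "pull_mor (pure_theory T P) (exp_incl T P) m
        = id_mor (pure_theory T P) (restr0 T P MA)
      \<longleftrightarrow> (\<forall>X \<in> types T. m (Base X) = ident Set_theory (ty_map MA (Base X)))"
    by (auto simp: pull_mor_def id_mor_def restr0_def pull_model_def thy_comp_def pure_theory_def
        exp_incl_def compose_def fun_eq_iff restrict_def)
  ultimately show ?thesis
    unfolding is_mor0_def model_mor_over_def model_mor_def pull_model_def by auto
qed

lemma is_model_at_unique:
  assumes "is_model_at T P MA \<alpha> M" "is_model_at T P MA \<alpha> N"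
  shows "M = N"
proof -
  have M: "thy_morphism T Set_theory M" and N: "thy_morphism T Set_theory N"
    using assms by (auto simp: is_model_at_def is_model0_iff)
  have ty: "ty_map M X = ty_map N X" if "X \<in> types T" for X
    using assms that by (auto simp: is_model_at_def is_model0_iff)
  have tm: "tm_map M f = tm_map N f" if f: "f \<in> terms T" for f
  proof (rule set_fun_eqI)
    note ty' = ty[OF src_types[OF f]] ty[OF tgt_types[OF f]]
    show "tm_map M f \<in> homs Set_theory (ty_map M (src T f)) (ty_map M (tgt T f))"
      using M homs_self[OF f] by (rule tm_map_homs)
    show "tm_map N f \<in> homs Set_theory (ty_map M (src T f)) (ty_map M (tgt T f))"
      unfolding ty' using N homs_self[OF f] by (rule tm_map_homs)
    show "app (tm_map M f) x = app (tm_map N f) x" if "x \<in> ty_map M (src T f)" for x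
      using assms f that by (simp add: is_model_at_def ty')
  qed
  show ?thesis
    using M N ty tm by (rule thy_map_eqI)
qed

text \<open>Agreement with \<open>MA\<close> on pure terms comes first: identities and projections
  are pure, so their preservation is inherited from \<open>MA\<close>. Composition is
  \<open>MA_prime_cmp\<close>, and products of types are preserved because a product of base types
  is again the base type of the product in \<open>T\<close>.\<close>

lemma is_model_at_exists:
  assumes \<alpha>: "\<alpha> \<in> ty_map MA Dist"
  shows "\<exists>M. is_model_at T P MA \<alpha> M"
proof
  define M :: "('o, 'm, 'a) thy_model" where "M = \<lparr>ty_map = \<lambda>X\<in>types T. ty_map MA (Base X),
    tm_map = \<lambda>f\<in>terms T. mk_fun (ty_map MA (Base (src T f))) (ty_map MA (Base (tgt T f)))
      (\<lambda>x. app (tm_map MA (exp_prime T P f)) (Tuple [\<alpha>, x]))\<rparr>"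
  have ty: "ty_map M X = ty_map MA (Base X)" if "X \<in> types T" for X
    using that by (simp add: M_def)
  have app: "app (tm_map M f) x = app (tm_map MA (exp_prime T P f)) (Tuple [\<alpha>, x])"
    if "f \<in> homs T X Y" "x \<in> ty_map MA (Base X)" for f X Y x
    using that by (simp add: M_def homs_def app_mk_fun)
  have homs: "tm_map M f \<in> homs Set_theory (ty_map MA (Base X)) (ty_map MA (Base Y))"
    if f: "f \<in> homs T X Y" for f X Y
  proof -
    have "app (tm_map MA (exp_prime T P f)) (Tuple [\<alpha>, x]) \<in> ty_map MA (Base Y)"
      if "x \<in> ty_map MA (Base X)" for x
      using MA_prime_homs[OF f] by (rule app_mem) (use \<alpha> that in \<open>auto simp: cart_pair\<close>)
    then show ?thesis
      using f by (auto simp: M_def homs_def[of T] intro: mk_fun_homs)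
  qed
  have pure: "tm_map M f = tm_map MA (exp_pure f)" if f: "f \<in> P" for f
    using homs[OF pure_homs[OF f]] tm_map_homs[OF MA exp_pure_homs[OF f]]
  proof (rule set_fun_eqI)
    fix x
    assume x: "x \<in> ty_map MA (Base (src T f))"
    show "app (tm_map M f) x = app (tm_map MA (exp_pure f)) x"
      using app[OF pure_homs[OF f] x] MA_prime_pure[OF f \<alpha> x] by simp
  qed
  have ident: "tm_map M (ident T X) = ident Set_theory (ty_map M X)" if X: "X \<in> types T" for X
  proof -
    have "exp_pure (ident T X) = ident (F_exp T P) (Base X)"
      using ident_homs[OF X] exp_class_eq[OF exp_eq.pure_id[OF X]]
      by (simp add: exp_pure_def homs_def F_exp_def)
    then show ?thesis
      using pure[OF pure_ident[OF X]] tm_map_ident[OF MA Base_types[OF X]] ty[OF X] by simp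
  qed
  have cmp: "tm_map M (cmp T g f) = cmp Set_theory (tm_map M g) (tm_map M f)"
    if f: "f \<in> homs T X Y" and g: "g \<in> homs T Y Z" for f g X Y Z
    using homs[OF cmp_homs[OF f g]] Sets.cmp_homs[OF homs[OF f] homs[OF g]]
  proof (rule set_fun_eqI)
    fix x
    assume x: "x \<in> ty_map MA (Base X)"
    have "app (cmp Set_theory (tm_map M g) (tm_map M f)) x = app (tm_map M g) (app (tm_map M f) x)"
      using homs[OF f] x by (rule app_cmp)
    also have "\<dots> = app (tm_map MA (exp_prime T P g))
        (Tuple [\<alpha>, app (tm_map MA (exp_prime T P f)) (Tuple [\<alpha>, x])])"
      using app[OF g app_mem[OF homs[OF f] x]] app[OF f x] by simp
    also have "\<dots> = app (tm_map M (cmp T g f)) x"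
      using MA_prime_cmp[OF f g \<alpha> x] app[OF cmp_homs[OF f g] x] by simp
    finally show "app (tm_map M (cmp T g f)) x
        = app (cmp Set_theory (tm_map M g) (tm_map M f)) x" ..
  qed
  have map_eq: "map (ty_map M) Xs = map (ty_map MA) (map Base Xs)" if "set Xs \<subseteq> types T" for Xs
    using that ty by auto
  have prodt: "ty_map M (prodt T Xs) = prodt Set_theory (map (ty_map M) Xs)"
    if Xs: "set Xs \<subseteq> types T" for Xs
  proof -
    have "set (map Base Xs) \<subseteq> types (F_exp T P)"
      using Xs Base_types by auto
    from MA_prodt[OF this] show ?thesis
      unfolding map_eq[OF Xs] by (simp add: exp_prod_Base prodt_Set ty[OF prodt_types[OF Xs]])
  qed
  have proj: "tm_map M (proj T Xs i) = proj Set_theory (map (ty_map M) Xs) i"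
    if Xs: "set Xs \<subseteq> types T" and i: "i < length Xs" for Xs i
  proof -
    have Bs: "set (map Base Xs) \<subseteq> types (F_exp T P)"
      using Xs Base_types by auto
    have "exp_pure (proj T Xs i) = proj (F_exp T P) (map Base Xs) i"
      using proj_homs[OF Xs i] exp_class_eq[OF exp_eq.pure_proj[OF Xs i]] i
      by (simp add: exp_pure_def homs_def F_exp_def exp_prod_Base)
    then show ?thesis
      using pure[OF pure_proj[OF Xs i]] tm_map_proj[OF MA Bs, of i] i
      unfolding map_eq[OF Xs] by simp
  qed
  have "thy_morphism T Set_theory M"
    unfolding thy_morphism_def
  proof (intro conjI ballI allI impI)
    show "ty_map M \<in> types T \<rightarrow>\<^sub>E types Set_theory"
      by (auto simp: M_def Set_theory_def)
    show "tm_map M \<in> terms T \<rightarrow>\<^sub>E terms Set_theory"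
      using homs_terms[OF homs[OF homs_self]] by (auto simp: M_def)
  next
    fix f
    assume f: "f \<in> terms T"
    show "src Set_theory (tm_map M f) = ty_map M (src T f)"
      and "tgt Set_theory (tm_map M f) = ty_map M (tgt T f)"
      using homs[OF homs_self[OF f]] ty src_types[OF f] tgt_types[OF f] by (simp_all add: homs_def)
  next
    fix f g
    assume "f \<in> terms T" "g \<in> terms T" "tgt T f = src T g"
    then show "tm_map M (cmp T g f) = cmp Set_theory (tm_map M g) (tm_map M f)"
      by (auto simp: homs_def intro: cmp)
  qed (use ident prodt proj equational_theory_axioms Sets.equational_theory_axioms in auto)
  then have "is_model0 T P MA M"
    using ty pure by (auto simp: is_model0_iff)
  moreover have "app (tm_map M f) x = app (tm_map MA (exp_prime T P f)) (Tuple [\<alpha>, x])"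
    if f: "f \<in> terms T" and x: "x \<in> ty_map M (src T f)" for f x
    using app[OF homs_self[OF f]] x ty[OF src_types[OF f]] by simp
  ultimately show "is_model_at T P MA \<alpha> M"
    by (auto simp: is_model_at_def)
qed

lemma is_model_at_model_at:
  assumes "\<alpha> \<in> ty_map MA Dist"
  shows "is_model_at T P MA \<alpha> (model_at T P MA \<alpha>)"
  unfolding model_at_def using is_model_at_exists[OF assms] is_model_at_unique by (metis theI)

lemma model_at_eq: "is_model_at T P MA \<alpha> M \<Longrightarrow> model_at T P MA \<alpha> = M"
  unfolding model_at_def using is_model_at_unique by blast

end


section \<open>Morphisms of models over the pure part\<close>

context exp_model
begin

text \<open>This makes \<open>subst_dist \<alpha> A\<close> usable as the component at
  \<open>A\<close> of a morphism from the pullback of \<open>M\<close>. At a product, strictness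
  turns both sides into literal cartesian products.\<close>

lemma subst_dist_mem:
  assumes \<alpha>: "\<alpha> \<in> ty_map MA Dist" and M: "is_model0 T P MA M"
    and A: "A \<in> types (F_exp T P)" and x: "x \<in> ty_map M (ty_map \<theta> A)"
  shows "subst_dist \<alpha> A x \<in> ty_map MA A"
  using A x
proof (induction arbitrary: x rule: F_exp_types_induct)
  case (base X)
  then show ?case
    using M by (simp add: exp_theta_Base is_model0_iff)
next
  case dist
  then show ?case
    using \<alpha> by simp
next
  case (prod As)
  have M': "thy_morphism T Set_theory M"
    using M by (simp add: is_model0_iff)
  have "set (map (ty_map \<theta>) As) \<subseteq> types T"
    using prod.hyps ty_map_types[OF exp_theta_morphism] by auto
  then have "x \<in> cart (map (ty_map M) (map (ty_map \<theta>) As))"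
    using prod.prems ty_map_prodt[OF exp_theta_morphism prod.hyps] ty_map_prodt[OF M']
    by (simp add: prodt_Set)
  then obtain xs where x: "x = Tuple xs" "length xs = length As"
    and xs: "\<And>i. i < length As \<Longrightarrow> xs ! i \<in> ty_map M (ty_map \<theta> (As ! i))"
    by (auto elim!: cartE)
  then have "subst_dist \<alpha> (As ! i) (xs ! i) \<in> ty_map MA (As ! i)" if "i < length As" for i
    using that prod.IH by simp
  then have "Tuple (map2 (subst_dist \<alpha>) As xs) \<in> cart (map (ty_map MA) As)"
    using x by (subst cart_iff) simp
  then show ?case
    using x MA_prodt[OF prod.hyps] by (simp add: prodt_F_exp subst_dist_exp_prod)
qed

lemma nat_trans_unique:
  assumes m: "nat_trans (F_exp T P) Set_theory N MA m"
    and n: "nat_trans (F_exp T P) Set_theory N MA n"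
    and base: "\<And>X. X \<in> types T \<Longrightarrow> m (Base X) = n (Base X)" and dist: "m Dist = n Dist"
  shows "m = n"
proof -
  have "m A = n A" if "A \<in> types (F_exp T P)" for A
    using that
  proof (induction rule: F_exp_types_induct)
    case (prod As)
    let ?A = "prodt (F_exp T P) As"
    have A: "?A \<in> types (F_exp T P)" and As: "set (map (ty_map MA) As) \<subseteq> types Set_theory"
      using E.prodt_types[OF prod.hyps] by (auto simp: Set_theory_def)
    show ?case
    proof (rule Sets.hom_prodt_eqI[OF _ _ As])
      show "m ?A \<in> homs Set_theory (ty_map N ?A) (prodt Set_theory (map (ty_map MA) As))"
        using nat_trans_homs[OF m A] ty_map_prodt[OF MA prod.hyps] by simp
      show "n ?A \<in> homs Set_theory (ty_map N ?A) (prodt Set_theory (map (ty_map MA) As))"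
        using nat_trans_homs[OF n A] ty_map_prodt[OF MA prod.hyps] by simp
      fix i
      assume "i < length (map (ty_map MA) As)"
      then have i: "i < length As"
        by simp
      note p = E.proj_homs[OF prod.hyps i]
      \<comment> \<open>Naturality at the projection trades the component at the product for the
        component at the factor.\<close>
      show "cmp Set_theory (proj Set_theory (map (ty_map MA) As) i) (m ?A)
          = cmp Set_theory (proj Set_theory (map (ty_map MA) As) i) (n ?A)"
        using nat_trans_eq[OF m p] nat_trans_eq[OF n p] prod.IH[OF nth_mem[OF i]]
          tm_map_proj[OF MA prod.hyps i] by simp
    qed
  qed (use base dist in auto)
  then show ?thesis
    using nat_trans_extensional[OF m] nat_trans_extensional[OF n] by (rule extensionalityI[rotated 2])
qed

text \<open>A condition on all elements of \<open>M(1)\<close> thereby becomes a condition at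
  \<open>Tuple []\<close>.\<close>

lemma ty_map_terminal:
  assumes "thy_morphism T Set_theory M"
  shows "ty_map M (prodt T []) = {Tuple []}"
  using ty_map_prodt[OF assms, of "[]"] by (simp add: prodt_Set cart_Nil)

lemma is_mor0_unique:
  assumes M: "is_model0 T P MA M" and m: "is_mor0 T P MA M m" and n: "is_mor0 T P MA M n"
    and eq: "app (m Dist) (Tuple []) = app (n Dist) (Tuple [])"
  shows "m = n"
proof -
  let ?N = "thy_comp (F_exp T P) M \<theta>"
  have m': "nat_trans (F_exp T P) Set_theory ?N MA m"
    and n': "nat_trans (F_exp T P) Set_theory ?N MA n"
    using m n by (auto simp: is_mor0_iff[OF M])
  have base: "m (Base X) = n (Base X)" if "X \<in> types T" for X
    using m n that by (auto simp: is_mor0_iff[OF M])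
  have M': "thy_morphism T Set_theory M"
    using M by (simp add: is_model0_iff)
  have "ty_map ?N Dist = {Tuple []}"
    using Dist_types ty_map_terminal[OF M'] by (simp add: thy_comp_def compose_def exp_theta_Dist)
  then have "m Dist = n Dist"
    using nat_trans_homs[OF m' Dist_types] nat_trans_homs[OF n' Dist_types] eq
    by (intro set_fun_eqI) auto
  then show ?thesis
    using m' n' base by (intro nat_trans_unique)
qed

text \<open>The component at \<open>A\<close> is \<open>subst_dist \<alpha> A\<close>. Naturality
  holds at \<open>f'\<close> by the choice of \<open>M\<close> and at pure terms because
  \<open>M\<close> and \<open>MA\<close> agree there; composites and tuples inherit it.\<close>

lemma is_mor0_exists:
  assumes \<alpha>: "\<alpha> \<in> ty_map MA Dist" and M: "is_model_at T P MA \<alpha> M"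
  shows "\<exists>m. is_mor0 T P MA M m \<and> app (m Dist) (Tuple []) = \<alpha>"
proof (intro exI conjI)
  let ?N = "thy_comp (F_exp T P) M \<theta>"
  have M0: "is_model0 T P MA M"
    using M by (simp add: is_model_at_def)
  have M_prime: "app (tm_map M f) x = app (tm_map MA (exp_prime T P f)) (Tuple [\<alpha>, x])"
    if "f \<in> terms T" "x \<in> ty_map M (src T f)" for f x
    using M that by (auto simp: is_model_at_def)
  have M': "thy_morphism T Set_theory M"
    using M0 by (simp add: is_model0_iff)
  have ty: "ty_map M X = ty_map MA (Base X)" if "X \<in> types T" for X
    using M0 that by (simp add: is_model0_iff)
  have M_pure: "tm_map M f = tm_map MA (exp_pure f)" if "f \<in> P" for f
    using M0 that by (simp add: is_model0_iff)
  have N: "thy_morphism (F_exp T P) Set_theory ?N"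
    using exp_theta_morphism M' by (rule thy_morphism_comp)
  have N_ty: "ty_map ?N A = ty_map M (ty_map \<theta> A)" if "A \<in> types (F_exp T P)" for A
    using that by (simp add: thy_comp_def compose_def)
  have N_tm: "tm_map ?N c = tm_map M (tm_map \<theta> c)" if "c \<in> terms (F_exp T P)" for c
    using that by (simp add: thy_comp_def compose_def)
  define m where "m = (\<lambda>A\<in>types (F_exp T P). mk_fun (ty_map ?N A) (ty_map MA A) (subst_dist \<alpha> A))"
  have m_homs: "m A \<in> homs Set_theory (ty_map ?N A) (ty_map MA A)"
    if A: "A \<in> types (F_exp T P)" for A
    using A subst_dist_mem[OF \<alpha> M0 A] by (auto simp: m_def N_ty intro: mk_fun_homs)
  have m_app: "app (m A) x = subst_dist \<alpha> A x"
    if "A \<in> types (F_exp T P)" "x \<in> ty_map ?N A" for A x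
    using that by (simp add: m_def app_mk_fun)
  \<comment> \<open>Isolated from the induction below because the tuple case also uses it, to move a
    projection across \<open>m\<close>.\<close>
  have proj_natural:
    "app (m (As ! i)) (app (tm_map ?N (proj (F_exp T P) As i)) x)
      = app (tm_map MA (proj (F_exp T P) As i)) (app (m (prodt (F_exp T P) As)) x)"
    if As: "set As \<subseteq> types (F_exp T P)" and i: "i < length As"
      and x: "x \<in> ty_map ?N (prodt (F_exp T P) As)" for As i x
  proof -
    let ?A = "prodt (F_exp T P) As" and ?p = "proj (F_exp T P) As i"
    note A = E.prodt_types[OF As]
    have x': "x \<in> cart (map (ty_map ?N) As)"
      using x ty_map_prodt[OF N As] by (simp add: prodt_Set)
    then obtain xs where xs: "x = Tuple xs" "length xs = length As"
      by (rule cartE) simp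
    have px: "app (tm_map ?N ?p) x = xs ! i"
      using tm_map_proj[OF N As i] app_proj[OF x', of i] xs by simp
    have "xs ! i \<in> ty_map ?N (As ! i)"
      using app_mem[OF tm_map_homs[OF N E.proj_homs[OF As i]] x] px by simp
    then have "app (m (As ! i)) (xs ! i) = subst_dist \<alpha> (As ! i) (xs ! i)"
      using m_app As i nth_mem by blast
    moreover have "app (m ?A) x = Tuple (map2 (subst_dist \<alpha>) As xs)"
      using m_app[OF A x] xs by (simp add: prodt_F_exp subst_dist_exp_prod)
    moreover have "app (m ?A) x \<in> cart (map (ty_map MA) As)"
      using app_mem[OF m_homs[OF A] x] ty_map_prodt[OF MA As] by (simp add: prodt_Set)
    ultimately show ?thesis
      using MA_proj[OF As i] px xs i by simp
  qed
  have natural: "app (m B) (app (tm_map ?N c) x) = app (tm_map MA c) (app (m A) x)"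
    if "c \<in> homs (F_exp T P) A B" "x \<in> ty_map ?N A" for A B c x
    \<comment> \<open>The induction predicate depends on the term alone, so the typing of
      \<open>c\<close> is kept as a premise with \<open>A\<close> and \<open>B\<close> arbitrary,
      and the cases recover them from the term.\<close>
    using that(1) that
  proof (induction arbitrary: A B x rule: F_exp_terms_induct)
    case (pure f)
    have f: "f \<in> homs T (src T f) (tgt T f)"
      using pure(1) by (rule pure_homs)
    have AB: "A = Base (src T f)" "B = Base (tgt T f)"
      using pure(2) exp_pure_homs[OF pure(1)] by (auto simp: homs_def)
    note types = Base_types[OF homs_types(1)[OF f]] Base_types[OF homs_types(2)[OF f]]
    have "app (tm_map ?N (exp_pure f)) x \<in> ty_map ?N B"
      using tm_map_homs[OF N pure(2)] pure(3) by (rule app_mem)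
    then show ?case
      using m_app types pure(3) N_tm[OF homs_terms[OF pure(2)]] exp_theta_pure[OF pure(1)]
        M_pure[OF pure(1)]
      by (simp add: AB)
  next
    case (prime f)
    let ?X = "src T f" and ?Y = "tgt T f"
    note f = homs_self[OF prime(1)]
    note XY = homs_types[OF f]
    have AB: "A = exp_prod T (dist_times ?X)" "B = Base ?Y"
      using prime(2) exp_prime_homs[OF f] by (auto simp: homs_def)
    have A: "A \<in> types (F_exp T P)" and B: "B \<in> types (F_exp T P)"
      using prime(2) by (auto dest: E.homs_types)
    have fx: "app (tm_map ?N (exp_prime T P f)) x \<in> ty_map ?N B"
      using tm_map_homs[OF N prime(2)] prime(3) by (rule app_mem)
    have Xs: "set [prodt T [], ?X] \<subseteq> types T"
      using XY terminal_types by auto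
    \<comment> \<open>\<theta> turns \<open>A \<times> X\<close> into \<open>1 \<times> X\<close>.
      An element is then a pair \<open>(u, y)\<close> with \<open>u\<close> in \<open>M(1)\<close>;
      \<open>m\<close> replaces \<open>u\<close> by \<alpha>, while the interpretation of
      \<open>f'\<close> discards \<open>u\<close>.\<close>
    have \<theta>A: "ty_map \<theta> A = prodt T [prodt T [], ?X]"
      using ty_map_prodt[OF exp_theta_morphism dist_times_types[OF XY(1)]] exp_theta_Base[OF XY(1)]
      by (simp add: AB prodt_F_exp exp_theta_Dist)
    then have "ty_map ?N A = cart [ty_map M (prodt T []), ty_map M ?X]"
      using N_ty[OF A] ty_map_prodt[OF M' Xs] by (simp add: prodt_Set)
    then obtain u y where x: "x = Tuple [u, y]" and y: "y \<in> ty_map M ?X"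
      and x': "x \<in> cart [ty_map M (prodt T []), ty_map M ?X]"
      using prime(3) by (auto simp: cart_pair)
    have p: "proj T [prodt T [], ?X] 1 \<in> homs T (ty_map \<theta> A) ?X"
      unfolding \<theta>A using XY(1) terminal_types by (rule snd_proj_homs)
    have "tm_map M (proj T [prodt T [], ?X] 1) = proj Set_theory (map (ty_map M) [prodt T [], ?X]) 1"
      using tm_map_proj[OF M' Xs, of 1] by simp
    then have "app (tm_map M (proj T [prodt T [], ?X] 1)) x = y"
      using x' app_proj[OF x'] by (simp add: x)
    then have "app (tm_map ?N (exp_prime T P f)) x = app (tm_map M f) y"
      using N_tm[OF homs_terms[OF prime(2)]] exp_theta_prime[OF prime(1)] tm_map_cmp[OF M' p f]
        app_cmp[OF tm_map_homs[OF M' p], of x "tm_map M f"] prime(3) N_ty[OF A]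
      by simp
    moreover have "app (m A) x = Tuple [\<alpha>, y]"
      using m_app[OF A prime(3)] subst_dist_exp_prod[of "[u, y]" "dist_times ?X" \<alpha> T]
      by (simp add: AB x)
    ultimately show ?case
      using m_app[OF B fx] M_prime[OF prime(1) y] by (simp add: AB)
  next
    case (ident C)
    then have [simp]: "A = C" "B = C"
      using E.ident_homs by (auto simp: homs_def)
    show ?case
      using ident m_homs[OF ident(1)] tm_map_ident[OF MA ident(1)] tm_map_ident[OF N ident(1)]
        app_mem[OF m_homs[OF ident(1)]]
      by (simp add: app_ident)
  next
    case (cmp A' B' C c d)
    have [simp]: "A' = A" "C = B"
      using E.cmp_homs[OF cmp(1,2)] cmp(5) by (auto simp: homs_def)
    have c: "c \<in> homs (F_exp T P) A B'" and d: "d \<in> homs (F_exp T P) B' B"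
      using cmp(1,2) by auto
    have cx: "app (tm_map ?N c) x \<in> ty_map ?N B'"
      using tm_map_homs[OF N c] cmp(6) by (rule app_mem)
    have mx: "app (m A) x \<in> ty_map MA A"
      using m_homs[OF E.homs_types(1)[OF c]] cmp(6) by (rule app_mem)
    show ?case
      unfolding tm_map_cmp[OF N c d] tm_map_cmp[OF MA c d]
        app_cmp[OF tm_map_homs[OF N c] cmp(6)] app_cmp[OF tm_map_homs[OF MA c] mx]
      using cmp(3)[OF c cmp(6)] cmp(4)[OF d cx] by simp
  next
    case (proj As i)
    note p = E.proj_homs[OF proj(1,2)]
    have "A = prodt (F_exp T P) As" "B = As ! i"
      using p proj(3) by (auto simp: homs_def)
    then show ?case
      using proj_natural[OF proj(1,2)] proj(4) by simp
  next
    case (tuple A' Bs c)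
    have [simp]: "A' = A" and B: "B = prodt (F_exp T P) Bs"
      using tuple(1,4) by (auto simp: homs_def)
    have c: "c \<in> homs (F_exp T P) A B"
      by (rule tuple)
    have mx: "app (m A) x \<in> ty_map MA A"
      using m_homs[OF E.homs_types(1)[OF c]] tuple(5) by (rule app_mem)
    have cx: "app (tm_map ?N c) x \<in> ty_map ?N B"
      using tm_map_homs[OF N c] tuple(5) by (rule app_mem)
    have MB: "ty_map MA B = cart (map (ty_map MA) Bs)"
      using MA_prodt[OF tuple(2)] by (simp add: B prodt_F_exp)
    show ?case
    proof (rule cart_eqI)
      show mcx: "app (m B) (app (tm_map ?N c) x) \<in> cart (map (ty_map MA) Bs)"
        unfolding MB[symmetric] using m_homs[OF E.homs_types(2)[OF c]] cx by (rule app_mem)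
      show cmx: "app (tm_map MA c) (app (m A) x) \<in> cart (map (ty_map MA) Bs)"
        unfolding MB[symmetric] using tm_map_homs[OF MA c] mx by (rule app_mem)
      fix i
      assume "i < length (map (ty_map MA) Bs)"
      then have i: "i < length Bs"
        by simp
      let ?p = "proj (F_exp T P) Bs i"
      have p: "?p \<in> homs (F_exp T P) B (Bs ! i)"
        unfolding B using tuple(2) i by (rule E.proj_homs)
      \<comment> \<open>Coordinate \<open>i\<close> is read off by a projection, which is moved
        across \<open>m\<close>; the induction hypothesis applies to the composite of
        \<open>c\<close> with that projection.\<close>
      have "untuple (app (m B) (app (tm_map ?N c) x)) ! i
          = app (tm_map MA ?p) (app (m B) (app (tm_map ?N c) x))"
        using MA_proj[OF tuple(2) i mcx] ..
      also have "\<dots> = app (m (Bs ! i)) (app (tm_map ?N ?p) (app (tm_map ?N c) x))"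
        using proj_natural[OF tuple(2) i, folded B, OF cx] ..
      also have "\<dots> = app (m (Bs ! i)) (app (tm_map ?N (cmp (F_exp T P) ?p c)) x)"
        unfolding tm_map_cmp[OF N c p] app_cmp[OF tm_map_homs[OF N c] tuple(5)] ..
      also have "\<dots> = app (tm_map MA (cmp (F_exp T P) ?p c)) (app (m A) x)"
        using E.cmp_homs[OF c p] tuple(5) by (rule tuple(3)[OF i])
      also have "\<dots> = app (tm_map MA ?p) (app (tm_map MA c) (app (m A) x))"
        unfolding tm_map_cmp[OF MA c p] app_cmp[OF tm_map_homs[OF MA c] mx] ..
      also have "\<dots> = untuple (app (tm_map MA c) (app (m A) x)) ! i"
        using MA_proj[OF tuple(2) i cmx] .
      finally show "untuple (app (m B) (app (tm_map ?N c) x)) ! i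
          = untuple (app (tm_map MA c) (app (m A) x)) ! i" .
    qed
  qed
  have "nat_trans (F_exp T P) Set_theory ?N MA m"
    unfolding nat_trans_def
  proof (intro conjI ballI)
    fix c
    assume c: "c \<in> terms (F_exp T P)"
    note c' = homs_self[OF c]
    note mA = m_homs[OF E.homs_types(1)[OF c']] and mB = m_homs[OF E.homs_types(2)[OF c']]
    note Nc = tm_map_homs[OF N c'] and MAc = tm_map_homs[OF MA c']
    show "cmp Set_theory (m (tgt (F_exp T P) c)) (tm_map ?N c)
        = cmp Set_theory (tm_map MA c) (m (src (F_exp T P) c))"
      using Sets.cmp_homs[OF Nc mB] Sets.cmp_homs[OF mA MAc]
      by (rule set_fun_eqI) (simp add: app_cmp[OF Nc] app_cmp[OF mA] natural[OF c'])
  qed (use N MA m_homs in \<open>auto simp: m_def\<close>)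
  moreover have "m (Base X) = ident Set_theory (ty_map MA (Base X))" if X: "X \<in> types T" for X
  proof -
    have "ty_map ?N (Base X) = ty_map MA (Base X)"
      using N_ty[OF Base_types[OF X]] exp_theta_Base[OF X] ty[OF X] by simp
    then show ?thesis
      using Base_types[OF X] by (auto simp: m_def mk_fun_def Set_theory_def)
  qed
  ultimately show "is_mor0 T P MA M m"
    by (simp add: is_mor0_iff[OF M0])
  show "app (m Dist) (Tuple []) = \<alpha>"
    using m_app[OF Dist_types] N_ty[OF Dist_types] ty_map_terminal[OF M']
    by (simp add: exp_theta_Dist)
qed

text \<open>Naturality at \<open>f'\<close> is evaluated at \<open>Tuple [Tuple [], y]\<close>. On
  one side \<theta> discards the first coordinate and leaves \<open>M(f)(y)\<close>; on the other,
  \<open>m\<close> sends this pair to \<open>Tuple [?\<alpha>, y]\<close>.\<close>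

lemma is_model_at_of_mor0:
  assumes M: "is_model0 T P MA M" and m: "is_mor0 T P MA M m"
  shows "app (m Dist) (Tuple []) \<in> ty_map MA Dist" (is "?\<alpha> \<in> _")
    and "is_model_at T P MA (app (m Dist) (Tuple [])) M"
proof -
  let ?N = "thy_comp (F_exp T P) M \<theta>"
  have m': "nat_trans (F_exp T P) Set_theory ?N MA m"
    using m by (simp add: is_mor0_iff[OF M])
  have base: "m (Base X) = ident Set_theory (ty_map MA (Base X))" if "X \<in> types T" for X
    using m that by (simp add: is_mor0_iff[OF M])
  have M': "thy_morphism T Set_theory M"
    using M by (simp add: is_model0_iff)
  have ty: "ty_map M X = ty_map MA (Base X)" if "X \<in> types T" for X
    using M that by (simp add: is_model0_iff)
  have N: "thy_morphism (F_exp T P) Set_theory ?N"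
    using exp_theta_morphism M' by (rule thy_morphism_comp)
  have N_ty: "ty_map ?N A = ty_map M (ty_map \<theta> A)" if "A \<in> types (F_exp T P)" for A
    using that by (simp add: thy_comp_def compose_def)
  have N_tm: "tm_map ?N c = tm_map M (tm_map \<theta> c)" if "c \<in> terms (F_exp T P)" for c
    using that by (simp add: thy_comp_def compose_def)
  have N_Dist: "ty_map ?N Dist = {Tuple []}"
    using N_ty[OF Dist_types] ty_map_terminal[OF M'] by (simp add: exp_theta_Dist)
  show \<alpha>: "?\<alpha> \<in> ty_map MA Dist"
    using nat_trans_homs[OF m' Dist_types] by (rule app_mem) (simp add: N_Dist)
  have "app (tm_map M f) y = app (tm_map MA (exp_prime T P f)) (Tuple [?\<alpha>, y])"
    if f: "f \<in> terms T" and y: "y \<in> ty_map M (src T f)" for f y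
  proof -
    let ?X = "src T f" and ?Y = "tgt T f"
    let ?A = "exp_prod T (dist_times ?X)" and ?x = "Tuple [Tuple [], y]"
    note f' = homs_self[OF f]
    note XY = homs_types[OF f'] and f'' = exp_prime_homs[OF f']
    note As = dist_times_types[OF XY(1)]
    have A: "?A \<in> types (F_exp T P)"
      using f'' by (rule E.homs_types)
    have N_Base: "ty_map ?N (Base X) = ty_map M X" if "X \<in> types T" for X
      using N_ty[OF Base_types[OF that]] exp_theta_Base[OF that] by simp
    have "ty_map ?N ?A = cart [ty_map ?N Dist, ty_map ?N (Base ?X)]"
      using ty_map_prodt[OF N As] by (simp add: prodt_F_exp prodt_Set)
    then have x': "?x \<in> cart [ty_map ?N Dist, ty_map ?N (Base ?X)]" and x: "?x \<in> ty_map ?N ?A"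
      using y N_Base[OF XY(1)] by (auto simp: N_Dist cart_pair)
    have mx: "app (m ?A) ?x \<in> cart [ty_map MA Dist, ty_map MA (Base ?X)]"
      using app_mem[OF nat_trans_homs[OF m' A] x] MA_dist_times[OF XY(1)] by simp
    \<comment> \<open>Naturality at the two projections forces \<open>m\<close> at
      \<open>A \<times> X\<close> to act as \<open>m Dist\<close> on the first coordinate and as the
      identity on the second.\<close>
    have proj: "untuple (app (m ?A) ?x) ! i = app (m (dist_times ?X ! i)) (untuple ?x ! i)"
      if i: "i < length (dist_times ?X)" for i
    proof -
      have p: "proj (F_exp T P) (dist_times ?X) i \<in> homs (F_exp T P) ?A (dist_times ?X ! i)"
        using E.proj_homs[OF As i] by (simp add: prodt_F_exp)
      have "app (m (dist_times ?X ! i)) (app (tm_map ?N (proj (F_exp T P) (dist_times ?X) i)) ?x)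
          = app (tm_map MA (proj (F_exp T P) (dist_times ?X) i)) (app (m ?A) ?x)"
        using nat_trans_eq[OF m' p] tm_map_homs[OF N p] nat_trans_homs[OF m' A] x
        by (rule cmp_set_fun_eqD)
      moreover have "app (tm_map MA (proj (F_exp T P) (dist_times ?X) i)) (app (m ?A) ?x)
          = untuple (app (m ?A) ?x) ! i"
        using MA_proj[OF As i] mx by simp
      moreover have "app (tm_map ?N (proj (F_exp T P) (dist_times ?X) i)) ?x = untuple ?x ! i"
        using tm_map_proj[OF N As i] app_proj[OF x'] by simp
      ultimately show ?thesis
        by simp
    qed
    have "untuple (app (m ?A) ?x) ! 0 = ?\<alpha>" "untuple (app (m ?A) ?x) ! 1 = y"
      using proj[of 0] proj[of 1] base[OF XY(1)] y ty[OF XY(1)] by (auto simp: app_ident)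
    then have mx_eq: "app (m ?A) ?x = Tuple [?\<alpha>, y]"
      using mx by (auto simp: cart_pair)
    have Xs: "set [prodt T [], ?X] \<subseteq> types T"
      using XY terminal_types by auto
    have p: "proj T [prodt T [], ?X] 1 \<in> homs T (prodt T [prodt T [], ?X]) ?X"
      using XY(1) terminal_types by (rule snd_proj_homs)
    have x'': "?x \<in> cart [ty_map M (prodt T []), ty_map M ?X]"
      using y ty_map_terminal[OF M'] by (simp add: cart_pair)
    have "app (tm_map ?N (exp_prime T P f)) ?x
        = app (tm_map M f) (app (tm_map M (proj T [prodt T [], ?X] 1)) ?x)"
      using N_tm[OF homs_terms[OF f'']] exp_theta_prime[OF f] tm_map_cmp[OF M' p f']
        app_cmp[OF tm_map_homs[OF M' p], of ?x "tm_map M f"] x'' ty_map_prodt[OF M' Xs]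
      by (simp add: prodt_Set)
    also have "app (tm_map M (proj T [prodt T [], ?X] 1)) ?x = y"
      using tm_map_proj[OF M' Xs, of 1] app_proj[OF x'', of 1] by simp
    finally have fx: "app (tm_map ?N (exp_prime T P f)) ?x = app (tm_map M f) y" .
    have "app (m (Base ?Y)) (app (tm_map ?N (exp_prime T P f)) ?x)
        = app (tm_map MA (exp_prime T P f)) (app (m ?A) ?x)"
      using nat_trans_eq[OF m' f''] tm_map_homs[OF N f''] nat_trans_homs[OF m' A] x
      by (rule cmp_set_fun_eqD)
    moreover have "app (tm_map M f) y \<in> ty_map MA (Base ?Y)"
      using app_mem[OF tm_map_homs[OF M' f'] y] ty[OF XY(2)] by simp
    ultimately show ?thesis
      using base[OF XY(2)] by (simp add: fx mx_eq app_ident)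
  qed
  then show "is_model_at T P MA ?\<alpha> M"
    using M by (simp add: is_model_at_def)
qed

section \<open>The bijection\<close>

lemma is_mor_at_iff:
  assumes "\<alpha> \<in> ty_map MA Dist"
  shows "is_mor_at T P MA \<alpha> m \<longleftrightarrow>
    is_mor0 T P MA (model_at T P MA \<alpha>) m \<and> app (m Dist) (Tuple []) = \<alpha>"
proof -
  have "thy_morphism T Set_theory (model_at T P MA \<alpha>)"
    using is_model_at_model_at[OF assms] by (simp add: is_model_at_def is_model0_iff)
  from ty_map_terminal[OF this] show ?thesis
    by (auto simp: is_mor_at_def)
qed

lemma is_mor_at_ex1:
  assumes \<alpha>: "\<alpha> \<in> ty_map MA Dist"
  shows "\<exists>!m. is_mor_at T P MA \<alpha> m"
proof -
  have M: "is_model0 T P MA (model_at T P MA \<alpha>)"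
    using is_model_at_model_at[OF \<alpha>] by (simp add: is_model_at_def)
  show ?thesis
    using is_mor0_exists[OF \<alpha> is_model_at_model_at[OF \<alpha>]] is_mor0_unique[OF M]
    unfolding is_mor_at_iff[OF \<alpha>] by metis
qed

lemma mor_at:
  assumes "\<alpha> \<in> ty_map MA Dist"
  shows "is_mor0 T P MA (model_at T P MA \<alpha>) (mor_at T P MA \<alpha>)"
    and "app (mor_at T P MA \<alpha> Dist) (Tuple []) = \<alpha>"
  using theI'[OF is_mor_at_ex1[OF assms]]
  unfolding mor_at_def[symmetric] unfolding is_mor_at_iff[OF assms] by auto

lemma bij_betw_pairs_over:
  "bij_betw (\<lambda>\<alpha>. (model_at T P MA \<alpha>, mor_at T P MA \<alpha>)) (ty_map MA Dist) (pairs_over T P MA)"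
\<comment> \<open>The inverse reads off the value of \<open>m Dist\<close> at the only element of
  \<open>M(1)\<close>.\<close>
proof (rule bij_betwI[where g = "\<lambda>(M, m). app (m Dist) (Tuple [])"])
  show "(\<lambda>\<alpha>. (model_at T P MA \<alpha>, mor_at T P MA \<alpha>)) \<in> ty_map MA Dist \<rightarrow> pairs_over T P MA"
    using is_model_at_model_at mor_at(1) by (auto simp: pairs_over_def is_model_at_def)
  show "(\<lambda>(M, m). app (m Dist) (Tuple [])) \<in> pairs_over T P MA \<rightarrow> ty_map MA Dist"
    using is_model_at_of_mor0(1) by (auto simp: pairs_over_def)
next
  fix \<alpha>
  assume "\<alpha> \<in> ty_map MA Dist"
  then show "(case (model_at T P MA \<alpha>, mor_at T P MA \<alpha>) of (M, m) \<Rightarrow> app (m Dist) (Tuple [])) = \<alpha>"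
    using mor_at(2) by simp
next
  fix p
  assume "p \<in> pairs_over T P MA"
  then obtain M m where p: "p = (M, m)" and M: "is_model0 T P MA M" and m: "is_mor0 T P MA M m"
    by (auto simp: pairs_over_def)
  let ?\<alpha> = "app (m Dist) (Tuple [])"
  note \<alpha> = is_model_at_of_mor0[OF M m]
  \<comment> \<open>The model is recovered first: \<open>mor_at\<close> is a morphism out of
    \<open>model_at\<close>, so only after this identification can it be compared with
    \<open>m\<close>.\<close>
  have M_eq: "model_at T P MA ?\<alpha> = M"
    using \<alpha>(2) by (rule model_at_eq)
  have "mor_at T P MA ?\<alpha> = m"
    using mor_at[OF \<alpha>(1)] m is_mor0_unique[OF M] unfolding M_eq by blast
  then show "(model_at T P MA (case p of (M, m) \<Rightarrow> app (m Dist) (Tuple [])),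
      mor_at T P MA (case p of (M, m) \<Rightarrow> app (m Dist) (Tuple []))) = p"
    using M_eq by (simp add: p)
qed

end

text \<open>The two unique existence claims say that the definite descriptions
  \<open>model_at\<close> and \<open>mor_at\<close> denote, so that the function shown to be
  bijective is the intended one.\<close>

theorem proposition3p7:
  fixes \<Theta> :: "('o, 'm) eqn_theory"
    and P :: "'m set"
    and M\<^sub>A :: "('o exp_type, ('o, 'm) exp_term, 'a) thy_model"
  assumes "decorated_theory \<Theta> P"
    and "model (F_exp \<Theta> P) M\<^sub>A"
  shows "(\<forall>\<alpha> \<in> ty_map M\<^sub>A Dist. \<exists>!M. is_model_at \<Theta> P M\<^sub>A \<alpha> M) \<and>
    (\<forall>\<alpha> \<in> ty_map M\<^sub>A Dist. \<exists>!m. is_mor_at \<Theta> P M\<^sub>A \<alpha> m) \<and>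
    bij_betw (\<lambda>\<alpha>. (model_at \<Theta> P M\<^sub>A \<alpha>, mor_at \<Theta> P M\<^sub>A \<alpha>))
      (ty_map M\<^sub>A Dist) (pairs_over \<Theta> P M\<^sub>A)"
proof -
  interpret exp_model \<Theta> P M\<^sub>A
    using assms by (intro exp_model.intro exp_model_axioms.intro)
  show ?thesis
    using is_model_at_exists is_model_at_unique is_mor_at_ex1 bij_betw_pairs_over by blast
qed

end
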